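(* Let $h$ be a prime divisor of the integer $q>1$, let $m\ge 1$, and let $\phi\colon \mathbb{Z}_q^m\to\mathbb{Z}_h$ be a normalized array (i.e. $\phi(\mathbf 0)=0$) with expansion $\phi'\colon E\to\mathbb{Z}_h$ of type $\mathbf{z}\in\{0,1\}^m$, $\mathbf z\neq\mathbf 0$. Let $L$, $K$ be the associated subgroups of $E$ and $\mu_{\mathbf z}\in Z^2(\mathbb{Z}_q^m,\langle\zeta_h\rangle)$ the associated cocycle (all taken with $\mathbf s=(q,\ldots,q)$ of length $m$). (a) The following are equivalent: (i) $\mu_{\mathbf z}\partial\phi$ is symmetric and orthogonal, i.e., $M_{\mu_{\mathbf z}\partial\phi}$ is a symmetric Butson Hadamard matrix (in $\mathrm{BH}(q^m,h)$); (ii) $\phi$ is a $\mathrm{GPhA}(q^m)$ of type $\mathbf z$; (iii) $\{g+K\in E/K \mid \phi'(g)=0\}$ is a non-splitting $(q^m,h,q^m,q^m/h)$-relative difference set in $E/K$ with forbidden subgroup $L/K$. (b) If $\mathbf z=\mathbf 1$ (the all-ones vector), then (i)–(iii) are equivalent to (iv) $\phi'\colon\mathbb{Z}_{hq}^m\to\mathbb{Z}_h$ is a generalized plateaued function with $$\Big|\sum_{x\in\mathbb{Z}_{hq}^m}\zeta_h^{\phi'(x)}\zeta_{hq}^{-v\cdot x}\Big|^2=\begin{cases}(h^2q)^m & v\in\mathcal F,\\ 0&\text{otherwise,}\end{cases}$$ for all $v\in\mathbb{Z}_{hq}^m$, where $\mathcal F=\{v\in\mathbb{Z}_{hq}^m\mid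 v\equiv\mathbf 1 \bmod h\}$ (congruence in every coordinate). (c) Let $h=q$ and $\mathbf z=\mathbf 1$. Suppose that for all $y=(y_1,\ldots,y_m)\in\mathbb{Z}_h^m\setminus\{\mathbf 0\}$ with $\sum_i y_i\equiv 0\bmod h$ there exists $x=(x_1,\ldots,x_m)\in\mathbb{Z}_h^m$ satisfying $$\phi(x+y)+\sum_i\lfloor (x_i+y_i)/h\rfloor\not\equiv\phi(x)+\phi(y)\bmod h,$$ where in the floor terms $x_i+y_i$ is the integer sum of representatives in $\{0,\ldots,h-1\}$. Then (i)–(iv) are equivalent to (v) $\phi'$ is a generalized partially bent function (GPBF).
   Context: $\mathbb{Z}_t=\{0,1,\ldots,t-1\}$ with addition modulo $t$; $\zeta_k=\exp(2\pi\sqrt{-1}/k)$; $\langle\zeta_h\rangle$ is the multiplicative group of $h$-th roots of unity; $v\cdot x$ is the standard inner product. Arrays and expansions. Let $\mathbf s=(s_1,\ldots,s_m)$ with integers $s_i>1$, $G=\mathbb{Z}_{s_1}\times\cdots\times\mathbb{Z}_{s_m}$, and $h\ge 2$. An $h$-ary $\mathbf s$-array is a map $\phi\colon G\to\mathbb{Z}_h$. For $\mathbf z=(z_1,\ldots,z_m)\in\{0,1\}^m$, the expansion of $\phi$ of type $\mathbf z$ is the map $\phi'\colon E\to\mathbb{Z}_h$, where $E=\mathbb{Z}_{(z_1(h-1)+1)s_1}\times\cdots\times\mathbb{Z}_{(z_m(h-1)+1)s_m}$, given by $\phi'(g_1,\ldots,g_m)=\phi(a)+b\bmod h$ with $b=\sum_i\lfloor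 g_i/s_i\rfloor$ and $a=(g_1\bmod s_1,\ldots,g_m\bmod s_m)$. Subgroups of $E$: $L=\{(g_1,\ldots,g_m)\in E\mid g_i=y_is_i$ with $0\le y_i<h$ if $z_i=1$, and $y_i=0$ if $z_i=0\}$ and $K=\{g\in L\mid\sum_i g_i/s_i\equiv 0\bmod h\}$. Autocorrelation. For a map $f\colon A\to\mathbb{Z}_h$ on a finite abelian group $A$ and $w\in A$, $AC_f(w)=\sum_{g\in A}\zeta_h^{f(g)-f(g+w)}$. The array $\phi$ is a $\mathrm{GPhA}(\mathbf s)$ (generalized perfect $h$-ary array) of type $\mathbf z$ if $AC_{\phi'}(g)=0$ for all $g\in E\setminus L$; $\mathrm{GPhA}(q^m)$ means $\mathbf s=(q,\ldots,q)$ of length $m$. A map $f\colon\mathbb{Z}_t^m\to\mathbb{Z}_h$ is a generalized partially bent function (GPBF) if $|AC_f(x)|\in\{0,t^m\}$ for all $x\in\mathbb{Z}_t^m$. A map $f\colon \mathbb{Z}_t^m\to\mathbb{Z}_h$ is a generalized plateaued function if the values $|\sum_{x}\zeta_h^{f(x)}\zeta_t^{-w\cdot x}|^2$, $w\in\mathbb{Z}_t^m$, lie in $\{0,\alpha\}$ for a single nonzero $\alpha$. Cocycles. For a finite group $G$ (here abelian), a (normalized) cocycle is a map $\psi\colon G\times G\to\langle\zeta_h\rangle$ with $\psi(a,b)\psi(ab,c)=\psi(a,bc)\psi(b,c)$ for all $a,b,c$ and $\psi(1,1)=1$; $Z^2(G,\langle\zeta_h\rangle)$ is the group of these. Identifying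 $\mathbb{Z}_h$ with $\langle\zeta_h\rangle$ via $j\mapsto\zeta_h^j$, the coboundary of a normalized array $\phi$ is $\partial\phi(x,y)=\zeta_h^{\phi(x+y)-\phi(x)-\phi(y)}$. The cocycle $\mu_{\mathbf z}$ (arising from the extension $1\to\langle\zeta_h\rangle\to E/K\to G\to 0$ with transversal $x\mapsto x+K$) is explicitly $\mu_{\mathbf z}(x,y)=\prod_{i:\,z_i=1}\zeta_h^{\lfloor(x_i+y_i)/s_i\rfloor}$, with $x_i+y_i$ the integer sum. $M_\psi=[\psi(a,b)]_{a,b\in G}$. $\mathrm{BH}(n,k)$ is the set of $n\times n$ matrices $M$ with entries in $\langle\zeta_k\rangle$ and $MM^*=nI_n$ (Butson Hadamard matrices). $\psi$ is orthogonal if $M_\psi\in\mathrm{BH}(|G|,h)$; $\psi$ is symmetric if $M_\psi$ is symmetric. Relative difference sets. Let $A$ be a group with normal subgroup $N$, $|N|=n$, $|A:N|=v$. A $(v,n,k,\lambda)$-relative difference set in $A$ relative to (with forbidden subgroup) $N$ is a $k$-subset $R$ of a transversal for $N$ in $A$ such that $|R\cap xR|=\lambda$ for all $x\in A\setminus N$ ($xR$ is written additively as $x+R$ when $A$ is additive). It is splitting if $N$ is a direct factor of $A$, and non-splitting otherwise. *)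

theory Defs
  imports
    "HOL-Analysis.Analysis"
    "HOL-Algebra.Product_Groups"
    "HOL-Number_Theory.Cong"
    "Jordan_Normal_Form.Schur_Decomposition"
begin

(* Throughout, a tuple (x_1, ..., x_m) is a function on {1..m} (nat \<Rightarrow> int, or nat \<Rightarrow> nat for
   s and z), Z_t is integer_mod_group t with carrier {0..<t}, and all groups are written
   multiplicatively, following HOL-Algebra. *)

definition cyc_prod :: "nat \<Rightarrow> (nat \<Rightarrow> nat) \<Rightarrow> (nat \<Rightarrow> int) monoid" where
  "cyc_prod m s = product_group {1..m} (\<lambda>i. integer_mod_group (s i))"

abbreviation cyc_pow :: "nat \<Rightarrow> nat \<Rightarrow> (nat \<Rightarrow> int) monoid" where
  "cyc_pow t m \<equiv> cyc_prod m (\<lambda>_. t)"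

definition zeta :: "nat \<Rightarrow> complex" where
  "zeta k = exp (2 * of_real pi * \<i> / of_nat k)"

definition unity_roots :: "nat \<Rightarrow> complex set" where
  "unity_roots k = {zeta k ^ j |j. True}"

definition hary_map :: "nat \<Rightarrow> ('a, 'b) monoid_scheme \<Rightarrow> ('a \<Rightarrow> int) \<Rightarrow> bool" where
  "hary_map h A f \<longleftrightarrow> f \<in> carrier A \<rightarrow> carrier (integer_mod_group h)"

definition exp_group :: "nat \<Rightarrow> nat \<Rightarrow> (nat \<Rightarrow> nat) \<Rightarrow> (nat \<Rightarrow> nat) \<Rightarrow> (nat \<Rightarrow> int) monoid" where
  "exp_group h m s z = cyc_prod m (\<lambda>i. (z i * (h - 1) + 1) * s i)"

definition expansion ::
  "nat \<Rightarrow> nat \<Rightarrow> (nat \<Rightarrow> nat) \<Rightarrow> ((nat \<Rightarrow> int) \<Rightarrow> int) \<Rightarrow> (nat \<Rightarrow> int) \<Rightarrow> int" where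
  "expansion h m s \<phi> g =
     (\<phi> (\<lambda>i\<in>{1..m}. g i mod int (s i)) + (\<Sum>i\<in>{1..m}. g i div int (s i))) mod int h"

definition L_sub :: "nat \<Rightarrow> nat \<Rightarrow> (nat \<Rightarrow> nat) \<Rightarrow> (nat \<Rightarrow> nat) \<Rightarrow> (nat \<Rightarrow> int) set" where
  "L_sub h m s z = {g \<in> carrier (exp_group h m s z).
     \<forall>i\<in>{1..m}. \<exists>y. g i = y * int (s i) \<and>
       (z i = 1 \<longrightarrow> 0 \<le> y \<and> y < int h) \<and> (z i = 0 \<longrightarrow> y = 0)}"

definition K_sub :: "nat \<Rightarrow> nat \<Rightarrow> (nat \<Rightarrow> nat) \<Rightarrow> (nat \<Rightarrow> nat) \<Rightarrow> (nat \<Rightarrow> int) set" where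
  "K_sub h m s z =
     {g \<in> L_sub h m s z. [(\<Sum>i\<in>{1..m}. g i div int (s i)) = 0] (mod int h)}"

definition AC :: "nat \<Rightarrow> ('a, 'b) monoid_scheme \<Rightarrow> ('a \<Rightarrow> int) \<Rightarrow> 'a \<Rightarrow> complex" where
  "AC h A f w = (\<Sum>g\<in>carrier A. zeta h powi (f g - f (g \<otimes>\<^bsub>A\<^esub> w)))"

definition is_GPhA ::
  "nat \<Rightarrow> nat \<Rightarrow> (nat \<Rightarrow> nat) \<Rightarrow> (nat \<Rightarrow> nat) \<Rightarrow> ((nat \<Rightarrow> int) \<Rightarrow> int) \<Rightarrow> bool" where
  "is_GPhA h m s z \<phi> \<longleftrightarrow> hary_map h (cyc_prod m s) \<phi> \<and>
     (\<forall>g \<in> carrier (exp_group h m s z) - L_sub h m s z.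
        AC h (exp_group h m s z) (expansion h m s \<phi>) g = 0)"

definition is_GPBF :: "nat \<Rightarrow> nat \<Rightarrow> nat \<Rightarrow> ((nat \<Rightarrow> int) \<Rightarrow> int) \<Rightarrow> bool" where
  "is_GPBF h t m f \<longleftrightarrow> hary_map h (cyc_pow t m) f \<and>
     (\<forall>x \<in> carrier (cyc_pow t m). cmod (AC h (cyc_pow t m) f x) \<in> {0, real (t ^ m)})"

definition spectrum_sum ::
  "nat \<Rightarrow> nat \<Rightarrow> nat \<Rightarrow> ((nat \<Rightarrow> int) \<Rightarrow> int) \<Rightarrow> (nat \<Rightarrow> int) \<Rightarrow> complex" where
  "spectrum_sum h t m f w =
     (\<Sum>x\<in>carrier (cyc_pow t m). zeta h powi (f x) * zeta t powi (- (\<Sum>i\<in>{1..m}. w i * x i)))"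

definition gen_plateaued :: "nat \<Rightarrow> nat \<Rightarrow> nat \<Rightarrow> ((nat \<Rightarrow> int) \<Rightarrow> int) \<Rightarrow> bool" where
  "gen_plateaued h t m f \<longleftrightarrow> hary_map h (cyc_pow t m) f \<and>
     (\<exists>\<alpha>::real. \<alpha> \<noteq> 0 \<and>
        (\<forall>w \<in> carrier (cyc_pow t m). (cmod (spectrum_sum h t m f w))\<^sup>2 \<in> {0, \<alpha>}))"

definition cocycles :: "('a, 'b) monoid_scheme \<Rightarrow> nat \<Rightarrow> ('a \<Rightarrow> 'a \<Rightarrow> complex) set" where
  "cocycles G h = {\<psi>.
     (\<forall>a\<in>carrier G. \<forall>b\<in>carrier G. \<psi> a b \<in> unity_roots h) \<and>
     (\<forall>a\<in>carrier G. \<forall>b\<in>carrier G. \<forall>c\<in>carrier G.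
        \<psi> a b * \<psi> (a \<otimes>\<^bsub>G\<^esub> b) c = \<psi> a (b \<otimes>\<^bsub>G\<^esub> c) * \<psi> b c) \<and>
     \<psi> \<one>\<^bsub>G\<^esub> \<one>\<^bsub>G\<^esub> = 1}"

definition coboundary ::
  "nat \<Rightarrow> ('a, 'b) monoid_scheme \<Rightarrow> ('a \<Rightarrow> int) \<Rightarrow> 'a \<Rightarrow> 'a \<Rightarrow> complex" where
  "coboundary h G \<phi> x y = zeta h powi (\<phi> (x \<otimes>\<^bsub>G\<^esub> y) - \<phi> x - \<phi> y)"

definition mu_cocycle ::
  "nat \<Rightarrow> nat \<Rightarrow> (nat \<Rightarrow> nat) \<Rightarrow> (nat \<Rightarrow> nat) \<Rightarrow> (nat \<Rightarrow> int) \<Rightarrow> (nat \<Rightarrow> int) \<Rightarrow> complex" where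
  "mu_cocycle h m s z x y =
     (\<Prod>i\<in>{i\<in>{1..m}. z i = 1}. zeta h powi ((x i + y i) div int (s i)))"

definition BH :: "nat \<Rightarrow> nat \<Rightarrow> complex mat set" where
  "BH n k = {M \<in> carrier_mat n n. elements_mat M \<subseteq> unity_roots k \<and>
     M * mat_adjoint M = of_nat n \<cdot>\<^sub>m 1\<^sub>m n}"

(* Rows and columns of the matrix of a cocycle are indexed by group elements; an arbitrary
   enumeration, the same for rows and columns, translates this to indices 0, ..., |G|-1.
   A different enumeration conjugates the matrix by a permutation matrix, which affects
   neither symmetry nor membership in BH. *)
definition elem_enum :: "('a, 'b) monoid_scheme \<Rightarrow> nat \<Rightarrow> 'a" where
  "elem_enum G = (SOME e. bij_betw e {..<order G} (carrier G))"

definition cocycle_mat :: "('a, 'b) monoid_scheme \<Rightarrow> ('a \<Rightarrow> 'a \<Rightarrow> complex) \<Rightarrow> complex mat" where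
  "cocycle_mat G \<psi> =
     mat (order G) (order G) (\<lambda>(i, j). \<psi> (elem_enum G i) (elem_enum G j))"

definition orthogonal_cocycle ::
  "('a, 'b) monoid_scheme \<Rightarrow> nat \<Rightarrow> ('a \<Rightarrow> 'a \<Rightarrow> complex) \<Rightarrow> bool" where
  "orthogonal_cocycle G h \<psi> \<longleftrightarrow> \<psi> \<in> cocycles G h \<and> cocycle_mat G \<psi> \<in> BH (order G) h"

definition symmetric_cocycle ::
  "('a, 'b) monoid_scheme \<Rightarrow> nat \<Rightarrow> ('a \<Rightarrow> 'a \<Rightarrow> complex) \<Rightarrow> bool" where
  "symmetric_cocycle G h \<psi> \<longleftrightarrow>
     \<psi> \<in> cocycles G h \<and> transpose_mat (cocycle_mat G \<psi>) = cocycle_mat G \<psi>"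

definition is_transversal :: "('a, 'b) monoid_scheme \<Rightarrow> 'a set \<Rightarrow> 'a set \<Rightarrow> bool" where
  "is_transversal A N T \<longleftrightarrow>
     T \<subseteq> carrier A \<and> (\<forall>C \<in> rcosets\<^bsub>A\<^esub> N. \<exists>!t. t \<in> T \<inter> C)"

definition is_RDS ::
  "('a, 'b) monoid_scheme \<Rightarrow> 'a set \<Rightarrow> nat \<Rightarrow> nat \<Rightarrow> nat \<Rightarrow> nat \<Rightarrow> 'a set \<Rightarrow> bool" where
  "is_RDS A N v n k l R \<longleftrightarrow>
     group A \<and> finite (carrier A) \<and> N \<lhd> A \<and> card N = n \<and> card (rcosets\<^bsub>A\<^esub> N) = v \<and>
     (\<exists>T. is_transversal A N T \<and> R \<subseteq> T) \<and> card R = k \<and>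
     (\<forall>x \<in> carrier A - N. card (R \<inter> (x <#\<^bsub>A\<^esub> R)) = l)"

definition direct_factor :: "('a, 'b) monoid_scheme \<Rightarrow> 'a set \<Rightarrow> bool" where
  "direct_factor A N \<longleftrightarrow> N \<lhd> A \<and>
     (\<exists>H. H \<lhd> A \<and> N \<inter> H = {\<one>\<^bsub>A\<^esub>} \<and> N <#>\<^bsub>A\<^esub> H = carrier A)"

definition is_nonsplitting_RDS ::
  "('a, 'b) monoid_scheme \<Rightarrow> 'a set \<Rightarrow> nat \<Rightarrow> nat \<Rightarrow> nat \<Rightarrow> nat \<Rightarrow> 'a set \<Rightarrow> bool" where
  "is_nonsplitting_RDS A N v n k l R \<longleftrightarrow> is_RDS A N v n k l R \<and> \<not> direct_factor A N"

end

theory Submission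
  imports Defs "HOL-Computational_Algebra.Polynomial_Factorial"
begin

text \<open>The expansion \<open>f = \<phi>'\<close> satisfies \<open>f (w + l) \<equiv> f w + f l\<close> modulo \<open>h\<close> for all \<open>w \<in> E\<close> and \<open>l \<in> L\<close>, and
  \<open>K\<close> is the kernel of the homomorphism \<open>f\<close> from \<open>L\<close> onto \<open>\<int>\<^sub>h\<close>. Hence \<open>AC f (a + l)\<close> agrees up to a root of unity
  with \<open>AC f a\<close>, which for \<open>a \<in> G\<close> is \<open>|L|\<close> times a root of unity times the conjugate of the row sum
  \<open>\<Sum>\<^sub>c \<psi>(a, c)\<close>, and the vanishing of the row sums with \<open>a \<noteq> 0\<close> is orthogonality. As \<open>h\<close> is prime, an integral
  relation \<open>\<Sum>\<^sub>j N\<^sub>j \<zeta>\<^sub>h\<^sup>j = 0\<close> forces all \<open>N\<^sub>j\<close> to be equal, which turns \<open>AC f g = 0\<close> into the counting condition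
  of a relative difference set. It cannot split: for a unit vector \<open>e\<close> with \<open>z\<^sub>i = 1\<close>, the \<open>q\<close>-th multiple
  of \<open>e\<close> generates \<open>L/K\<close>, whereas \<open>q\<close> annihilates \<open>L/K\<close>. For \<open>z = 1\<close> the spectrum is always supported on
  \<open>F\<close>, and its squared modulus is the Fourier transform of \<open>AC f\<close>.\<close>

subsection \<open>Integral relations between roots of unity of prime order\<close>

text \<open>The expansion is not a homomorphism on \<open>E\<close>, and \<open>G\<close> lies in
  \<open>E\<close> merely as a set of representatives modulo \<open>L\<close>; the failure of
  additivity on these representatives is exactly the exponent of \<open>\<psi>\<close>. Every
  condition is therefore compared with one statement, that \<open>AC\<close> vanishes off
  \<open>L\<close>, which is a condition on whole cosets of \<open>L\<close>. The set F consists of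
  the v for which the character given by v agrees on \<open>L\<close> with the one given by the
  expansion, and the constant (h^2 q)^m is |E| |L|. Condition (v) is a priori weaker than (ii),
  because |AC| = |E| might also occur at some g outside \<open>L\<close>. The expansion would then
  be additive along g. For h = q this forces the coordinates of g to sum to 0 modulo h, and after
  removal of the \<open>L\<close>-part it makes the expansion additive along the nonzero residue of
  g modulo q, at all points of \<open>G\<close>. This is the situation that the hypothesis of (c)
  excludes.\<close>

lemma eisenstein_degree:
  fixes f a b :: "int poly" and p :: int
  assumes p: "prime p" and f: "f = a * b"
    and lc: "lead_coeff f = 1"
    and low: "\<And>i. i < degree f \<Longrightarrow> p dvd coeff f i"
    and sq: "\<not> p\<^sup>2 dvd coeff f 0"
  shows "degree a = 0 \<or> degree b = 0"
proof -
  \<comment> \<open>By symmetry it suffices that \<open>p\<close> divides the constant coefficient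
    of \<open>a\<close> and not that of \<open>b\<close>. At the least index k at which
    \<open>p\<close> fails to divide the coefficient of \<open>a\<close>, a single term of the
    convolution escapes \<open>p\<close>. So \<open>p\<close> does not divide coefficient k of
    \<open>f\<close>, which puts k at degree f or beyond and leaves no degree for
    \<open>b\<close>.\<close>
  have main: "degree b = 0"
    if f: "f = a * b" and nd: "\<not> p dvd coeff b 0" and d: "p dvd coeff a 0" for a b :: "int poly"
  proof -
    have "f \<noteq> 0" using lc by auto
    hence nz: "a \<noteq> 0" "b \<noteq> 0" using f by auto
    have "lead_coeff a * lead_coeff b = 1" using lc by (simp add: f lead_coeff_mult)
    hence "lead_coeff a dvd 1" by (metis dvd_triv_left)
    hence "\<not> p dvd lead_coeff a"
      using p by (meson dvd_trans not_prime_unit)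
    then obtain k where k: "\<not> p dvd coeff a k" "\<And>i. i < k \<Longrightarrow> p dvd coeff a i"
      using exists_least_iff[of "\<lambda>k. \<not> p dvd coeff a k"] by blast
    have "coeff f k = (\<Sum>i\<le>k. coeff a i * coeff b (k - i))" by (simp add: f coeff_mult)
    also have "\<dots> = coeff a k * coeff b 0 + (\<Sum>i<k. coeff a i * coeff b (k - i))"
      by (simp add: lessThan_Suc_atMost[symmetric])
    finally have eq: "coeff f k = coeff a k * coeff b 0 + (\<Sum>i<k. coeff a i * coeff b (k - i))" .
    have "p dvd (\<Sum>i<k. coeff a i * coeff b (k - i))"
      by (intro dvd_sum dvd_mult2 k) auto
    moreover have "\<not> p dvd coeff a k * coeff b 0"
      using k(1) nd p by (simp add: prime_dvd_mult_iff)
    ultimately have "\<not> p dvd coeff f k" unfolding eq by (simp add: dvd_add_left_iff)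
    hence "k \<ge> degree f" using low[of k] by linarith
    moreover have "k \<le> degree a" using k(1) by (metis dvd_0_right le_degree)
    moreover have "degree f = degree a + degree b" using nz by (simp add: f degree_mult_eq)
    ultimately show ?thesis by linarith
  qed
  show ?thesis
  proof (cases "degree f = 0")
    case True
    moreover have "f \<noteq> 0" using lc by auto
    ultimately show ?thesis by (auto simp: f degree_mult_eq)
  next
    case False
    have c0: "coeff f 0 = coeff a 0 * coeff b 0" by (simp add: f coeff_mult)
    have "p dvd coeff a 0 * coeff b 0" using low[of 0] False c0 by simp
    hence "p dvd coeff a 0 \<or> p dvd coeff b 0" using p by (simp add: prime_dvd_mult_iff)
    moreover have "\<not> (p dvd coeff a 0 \<and> p dvd coeff b 0)"
      using sq unfolding c0 by (auto simp: power2_eq_square intro: mult_dvd_mono)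
    ultimately show ?thesis using main[of a b] main[of b a] f by (auto simp: mult.commute)
  qed
qed

definition cyclotomic_prime :: "nat \<Rightarrow> int poly" where
  "cyclotomic_prime p = (\<Sum>i<p. monom 1 i)"

lemma degree_cyclotomic_prime:
  assumes "p > 0" shows "degree (cyclotomic_prime p) = p - 1" "lead_coeff (cyclotomic_prime p) = 1"
proof -
  have c: "coeff (cyclotomic_prime p) n = (if n < p then 1 else 0)" for n
    by (simp add: cyclotomic_prime_def coeff_sum)
  show d: "degree (cyclotomic_prime p) = p - 1"
    using assms by (intro antisym degree_le le_degree) (auto simp: c)
  show "lead_coeff (cyclotomic_prime p) = 1"
    using assms by (simp add: d c)
qed

text \<open>The geometric series (Y - 1)(1 + Y + ... + Y^(p-1)) = Y^p - 1 at Y = X + 1. The factor X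
  avoids a division and costs one shift of the index when the binomial coefficients are read
  off.\<close>

lemma pcompose_cyclotomic_prime:
  "[:0, 1:] * pcompose (cyclotomic_prime p) [:1, 1:] = [:1, 1:] ^ p - 1"
proof -
  have "pcompose (cyclotomic_prime p) [:1, 1:] = (\<Sum>i<p. [:1, 1:] ^ i)"
    unfolding cyclotomic_prime_def pcompose_sum
    by (simp add: monom_altdef pcompose_smult pcompose_hom.hom_power pcompose_pCons)
  moreover have "[:1, 1:] ^ p - 1 = ([:1, 1:] - 1) * (\<Sum>i<p. [:1, 1:: int:] ^ i)"
    by (rule power_diff_1_eq)
  moreover have "[:1, 1:] - 1 = [:0, 1::int:]" by (simp add: one_pCons)
  ultimately show ?thesis by simp
qed

text \<open>Eisenstein's criterion applies after the substitution X + 1 for X: coefficient i becomes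
  p choose (i + 1), divisible by p below the leading one, and the constant coefficient is p
  itself.\<close>

lemma irreducible_cyclotomic_prime:
  assumes p: "prime p" shows "irreducible (cyclotomic_prime p)"
proof (rule irreducibleI)
  let ?F = "cyclotomic_prime p"
  let ?f = "pcompose ?F [:1, 1:]"
  have p2: "p \<ge> 2" using p by (rule prime_ge_2_nat)
  have deg: "degree ?F = p - 1" and lc: "lead_coeff ?F = 1"
    using degree_cyclotomic_prime p2 by auto
  show "?F \<noteq> 0" using deg p2 by auto
  show "\<not> ?F dvd 1"
  proof
    assume "?F dvd 1"
    hence "degree ?F = 0" by (auto simp: is_unit_poly_iff)
    thus False using deg p2 by simp
  qed
  have cf: "coeff ?f i = int (p choose Suc i)" for i
  proof -
    have "coeff ?f i = coeff ([:0, 1:] * ?f) (Suc i)" by simp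
    also have "\<dots> = coeff ([:1, 1:] ^ p) (Suc i)"
      unfolding pcompose_cyclotomic_prime by (simp add: one_pCons)
    also have "\<dots> = int (p choose Suc i)"
    proof (cases "Suc i \<le> p")
      case True
      thus ?thesis using coeff_linear_poly_power[of "Suc i" p 1 "1::int"] by simp
    next
      case False
      moreover have "degree ([:1, 1::int:] ^ p) = p" by (simp add: degree_power_eq)
      ultimately show ?thesis by (simp add: coeff_eq_0 binomial_eq_0)
    qed
    finally show ?thesis .
  qed
  fix a b assume ab: "?F = a * b"
  have "degree (pcompose a [:1, 1:]) = 0 \<or> degree (pcompose b [:1, 1:]) = 0"
  proof (rule eisenstein_degree)
    show "prime (int p)" using p by simp
    show "?f = pcompose a [:1, 1:] * pcompose b [:1, 1:]" by (simp add: ab pcompose_mult)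
    show "lead_coeff ?f = 1" using cf[of "p - 1"] p2 deg by simp
    show "int p dvd coeff ?f i" if "i < degree ?f" for i
    proof -
      have "p dvd p choose Suc i" using that deg p by (intro dvd_choose_prime) auto
      thus ?thesis unfolding cf by simp
    qed
    have "\<not> p * p dvd p" using p2 by (auto dest!: dvd_imp_le)
    thus "\<not> (int p)\<^sup>2 dvd coeff ?f 0"
      unfolding cf by (simp add: power2_eq_square flip: of_nat_mult)
  qed
  \<comment> \<open>Over the integers a factor of degree 0 need not be a unit; that the product is
    monic makes it one.\<close>
  moreover have "lead_coeff a * lead_coeff b = 1" using lc by (simp add: ab lead_coeff_mult)
  hence "lead_coeff a dvd 1" "lead_coeff b dvd 1" by (metis dvd_triv_left, metis dvd_triv_right)
  moreover have "c dvd 1" if "degree (pcompose c [:1, 1:]) = 0" "lead_coeff c dvd 1" for c :: "int poly"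
    using that by (auto simp: is_unit_poly_iff elim!: degree_eq_zeroE)
  ultimately show "a dvd 1 \<or> b dvd 1" by blast
qed

text \<open>Let M have least degree among the nonzero integer polynomials vanishing at
  \<open>\<xi>\<close>. Pseudo-division leaves no remainder, so c F = M Q with a nonzero integer c.
  As F is prime in the factorial ring of integer polynomials, it divides M, which gives the bound,
  or Q. In the latter case cancelling F leaves c = M Q', so M would be a nonzero constant with a
  root.\<close>

lemma root_of_irreducible_degree_le:
  fixes F P :: "int poly" and \<xi> :: complex
  assumes F: "irreducible F" "poly (of_int_poly F) \<xi> = 0"
    and P: "poly (of_int_poly P) \<xi> = 0" "P \<noteq> 0"
  shows "degree F \<le> degree P"
proof -
  let ?V = "\<lambda>P. P \<noteq> 0 \<and> poly (of_int_poly P) \<xi> = 0"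
  define M where "M = arg_min degree ?V"
  have M: "?V M" unfolding M_def using arg_min_natI[of ?V P degree] P by simp
  have min: "degree M \<le> degree Q" if "?V Q" for Q
    unfolding M_def using arg_min_nat_le[of ?V Q degree] that by simp
  obtain Q R where QR: "pseudo_divmod F M = (Q, R)" by (cases "pseudo_divmod F M")
  define c where "c = coeff M (degree M) ^ (Suc (degree F) - degree M)"
  have eq: "Polynomial.smult c F = M * Q + R" and R: "R = 0 \<or> degree R < degree M"
    using pseudo_divmod[OF _ QR] M unfolding c_def by auto
  have "poly (of_int_poly (Polynomial.smult c F)) \<xi> = 0" using F(2) by (simp add: of_int_hom.map_poly_hom_smult)
  hence "poly (of_int_poly R) \<xi> = 0"
    using M unfolding eq by (simp add: of_int_poly_hom.hom_add of_int_poly_hom.hom_mult)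
  hence "R = 0" using R min[of R] by (meson linorder_not_less)
  hence eq: "Polynomial.smult c F = M * Q" using eq by simp
  have c: "c \<noteq> 0" using M unfolding c_def by auto
  have Fp: "prime_elem F" using F(1) by (rule irreducible_imp_prime_poly)
  have "F dvd M * Q" by (metis eq dvd_smult dvd_refl)
  hence "F dvd M \<or> F dvd Q" using Fp prime_elem_dvd_mult_iff by blast
  thus ?thesis
  proof
    assume "F dvd M"
    hence "degree F \<le> degree M" using M by (intro dvd_imp_degree_le) auto
    thus ?thesis using min[of P] P by simp
  next
    assume "F dvd Q"
    then obtain Q' where "Q = F * Q'" by (elim dvdE)
    hence "F * [:c:] = F * (M * Q')" using eq by (simp add: mult_ac)
    hence cM: "[:c:] = M * Q'" using Fp by (subst (asm) mult_left_cancel) auto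
    have "M \<noteq> 0" "Q' \<noteq> 0" using c cM by auto
    hence "degree M + degree Q' = 0" by (metis cM degree_mult_eq degree_pCons_0)
    then obtain d where d: "M = [:d:]" by (auto elim: degree_eq_zeroE)
    with M have False by (auto simp: map_poly_pCons)
    thus ?thesis ..
  qed
qed

section \<open>Powers of the standard roots of unity and their integral relations\<close>

lemma zeta_cis: "zeta k = cis (2 * pi / k)"
  by (simp add: zeta_def cis_conv_exp mult_ac)

lemma zeta_nonzero [simp]: "zeta k \<noteq> 0"
  by (simp add: zeta_cis)

lemma zeta_powi_cis: "zeta k powi n = cis (2 * pi * n / k)"
  by (simp add: zeta_cis cis_power_int mult_ac)

lemma norm_zeta_powi [simp]: "cmod (zeta k powi n) = 1"
  by (simp add: zeta_powi_cis)

lemma cnj_zeta_powi: "cnj (zeta k powi n) = zeta k powi (- n)"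
  by (simp add: zeta_powi_cis cis_cnj)

lemma zeta_powi_eq_1_iff:
  assumes "k > 0" shows "zeta k powi n = 1 \<longleftrightarrow> int k dvd n"
proof
  assume "zeta k powi n = 1"
  hence "cos (2 * pi * n / k) = 1" by (simp add: zeta_powi_cis complex_eq_iff)
  then obtain j :: int where "2 * pi * n / k = j * 2 * pi" by (auto simp: cos_one_2pi_int)
  hence "real_of_int n = real_of_int (j * int k)" using assms by (simp add: field_simps)
  hence "n = j * int k" by linarith
  thus "int k dvd n" by simp
next
  assume "int k dvd n"
  then obtain j where "n = int k * j" by (elim dvdE)
  hence "2 * pi * n / k = 2 * pi * of_int j" using assms by simp
  thus "zeta k powi n = 1" by (simp only: zeta_powi_cis cis_multiple_2pi[OF Ints_of_int])
qed

lemma zeta_powi_cong: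
  assumes "[a = b] (mod int k)" "k > 0" shows "zeta k powi a = zeta k powi b"
proof -
  have "zeta k powi (a - b) = 1"
    using assms by (simp add: zeta_powi_eq_1_iff cong_iff_dvd_diff)
  thus ?thesis by (simp add: power_int_diff)
qed

text \<open>Serves for both factors of h q: characters of Z_hq take values in the h-th roots of
  unity on multiples of q, and in the q-th roots of unity on multiples of h.\<close>

lemma zeta_mult_powi: "q > 0 \<Longrightarrow> zeta (h * q) powi (int q * n) = zeta h powi n"
  by (simp add: zeta_powi_cis mult.assoc)

lemma zeta_powi_in_unity_roots:
  assumes "k > 0" shows "zeta k powi n \<in> unity_roots k"
proof -
  have "[n = int (nat (n mod int k))] (mod int k)" using assms by (simp add: cong_def)
  hence "zeta k powi n = zeta k powi int (nat (n mod int k))" using assms by (rule zeta_powi_cong)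
  also have "\<dots> = zeta k ^ nat (n mod int k)" by (rule power_int_of_nat)
  finally show ?thesis unfolding unity_roots_def by blast
qed

lemma sum_zeta_powers:
  assumes "k > 1" shows "(\<Sum>j<k. zeta k ^ j) = 0"
proof -
  have "zeta k \<noteq> 1" using zeta_powi_eq_1_iff[of k 1] assms by auto
  moreover have "zeta k ^ k = 1" using zeta_powi_eq_1_iff[of k "int k"] assms by simp
  ultimately show ?thesis by (simp add: sum_gp_strict)
qed

text \<open>Subtracting the last coefficient times the vanishing sum of all p-th roots of unity
  lowers the degree below p - 1. The remaining integer polynomial still vanishes at
  \<open>zeta p\<close>, a root of the irreducible cyclotomic polynomial of degree p - 1, so it is
  zero.\<close>

lemma sum_prime_roots_eq_0_imp_const:
  fixes c :: "nat \<Rightarrow> int"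
  assumes p: "prime p" and sum: "(\<Sum>j<p. of_int (c j) * zeta p ^ j) = 0" and "i < p" "j < p"
  shows "c i = c j"
proof -
  have p2: "p \<ge> 2" using p by (rule prime_ge_2_nat)
  define P where "P = (\<Sum>j<p. monom (c j - c (p - 1)) j)"
  have cf: "coeff P n = (if n < p then c n - c (p - 1) else 0)" for n
    by (simp add: P_def coeff_sum)
  have ev: "poly (of_int_poly (\<Sum>j<p. monom (d j) j)) (zeta p) = (\<Sum>j<p. of_int (d j) * zeta p ^ j)"
    for d :: "nat \<Rightarrow> int"
    by (simp add: of_int_poly_hom.hom_sum poly_sum poly_monom)
  have "poly (of_int_poly P) (zeta p) = 0"
    unfolding P_def ev using sum sum_zeta_powers[of p] p2
    by (simp add: left_diff_distrib sum_subtractf flip: sum_distrib_left)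
  moreover have "poly (of_int_poly (cyclotomic_prime p)) (zeta p) = 0"
    unfolding cyclotomic_prime_def ev using sum_zeta_powers[of p] p2 by simp
  moreover have "degree P < p - 1" if "P \<noteq> 0"
  proof -
    have "degree P \<le> p - 1" by (rule degree_le) (auto simp: cf)
    moreover have "coeff P (p - 1) = 0" by (simp add: cf)
    hence "degree P \<noteq> p - 1" using that by (metis leading_coeff_0_iff)
    ultimately show ?thesis by simp
  qed
  ultimately have "P = 0"
    using root_of_irreducible_degree_le[OF irreducible_cyclotomic_prime[OF p], of "zeta p" P]
      degree_cyclotomic_prime[of p] p2 by fastforce
  thus ?thesis using cf[of i] cf[of j] assms(3,4) by simp
qed

text \<open>Reindexing by T multiplies the sum by a. All vanishing character sums below come from
  such a shift by a multiple of a unit vector.\<close>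

lemma sum_eq_0_by_shift:
  fixes F :: "'a \<Rightarrow> complex"
  assumes "bij_betw T S S" "\<And>x. x \<in> S \<Longrightarrow> F (T x) = a * F x" "a \<noteq> 1"
  shows "sum F S = 0"
proof -
  have "sum F S = (\<Sum>x\<in>S. F (T x))" by (rule sum.reindex_bij_betw[OF assms(1), symmetric])
  also have "\<dots> = a * sum F S" by (simp add: assms(2) sum_distrib_left)
  finally show ?thesis using assms(3) by simp
qed

text \<open>Expand \<open>\<Sum>i. |s - n u\<^sub>i|\<^sup>2 = 0\<close>, where \<open>s\<close> is the sum and \<open>n\<close> the number of terms.\<close>

lemma sum_unimodular_maximal_imp_const:
  fixes u :: "'a \<Rightarrow> complex"
  assumes S: "finite S" and u: "\<And>x. x \<in> S \<Longrightarrow> cmod (u x) = 1" and s: "cmod (sum u S) = card S"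
    and "x \<in> S" "y \<in> S"
  shows "u x = u y"
proof -
  define n s where "n = card S" and "s = sum u S"
  have n: "n > 0" using S \<open>x \<in> S\<close> by (auto simp: n_def card_gt_0_iff)
  have 1: "(cmod (s - of_nat n * u i))\<^sup>2 = 2 * real n ^ 2 - 2 * real n * Re (s * cnj (u i))" if "i \<in> S" for i
  proof -
    have "(cmod (s - of_nat n * u i))\<^sup>2 = (cmod s)\<^sup>2 + (real n)\<^sup>2 * (cmod (u i))\<^sup>2 - 2 * real n * Re (s * cnj (u i))"
      unfolding cmod_power2 by (simp add: power2_eq_square algebra_simps)
    thus ?thesis using u[OF that] s by (simp add: n_def s_def)
  qed
  have "(\<Sum>i\<in>S. Re (s * cnj (u i))) = Re (s * cnj s)"
    by (simp add: s_def sum_distrib_left)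
  also have "\<dots> = (cmod s)\<^sup>2" unfolding cmod_power2 by (simp add: power2_eq_square)
  also have "\<dots> = real n ^ 2" using s by (simp add: s_def n_def)
  finally have 2: "(\<Sum>i\<in>S. Re (s * cnj (u i))) = real n ^ 2" .
  have "(\<Sum>i\<in>S. (cmod (s - of_nat n * u i))\<^sup>2) =
      (\<Sum>i\<in>S. 2 * real n ^ 2 - 2 * real n * Re (s * cnj (u i)))"
    by (intro sum.cong refl 1)
  also have "\<dots> = real n * (2 * real n ^ 2) - 2 * real n * (\<Sum>i\<in>S. Re (s * cnj (u i)))"
    unfolding sum_subtractf sum_distrib_left by (simp add: n_def)
  also have "\<dots> = 0" unfolding 2 by simp
  finally have "(\<Sum>i\<in>S. (cmod (s - of_nat n * u i))\<^sup>2) = 0" .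
  hence "(cmod (s - of_nat n * u i))\<^sup>2 = 0" if "i \<in> S" for i
    using that S by (subst (asm) sum_nonneg_eq_0_iff) auto
  hence eq: "of_nat n * u i = s" if "i \<in> S" for i using that by simp
  have "of_nat n * u x = of_nat n * u y" unfolding eq[OF assms(4)] eq[OF assms(5)] ..
  thus ?thesis using n by simp
qed

subsection \<open>Maps that are additive along a subgroup\<close>

text \<open>Given a complement H, write e = a b with a in N and b in H. The n-th power kills a, so
  e^n = b^n lies in both N and H, which meet trivially.\<close>

lemma (in comm_group) not_direct_factor_if_power:
  assumes N: "subgroup N G" and e: "e \<in> carrier G"
    and eN: "e [^] (n::nat) \<in> N" "e [^] n \<noteq> \<one>" and exp: "\<And>x. x \<in> N \<Longrightarrow> x [^] n = \<one>"
  shows "\<not> direct_factor G N"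
proof
  assume "direct_factor G N"
  then obtain H where H: "H \<lhd> G" "N \<inter> H = {\<one>}" "N <#> H = carrier G"
    unfolding direct_factor_def by blast
  have Hs: "subgroup H G" using H(1) by (rule normal_imp_subgroup)
  have "e \<in> N <#> H" using e H(3) by simp
  then obtain a b where ab: "a \<in> N" "b \<in> H" "e = a \<otimes> b" by (auto simp: set_mult_def)
  have c: "a \<in> carrier G" "b \<in> carrier G"
    by (rule subgroup.mem_carrier[OF N ab(1)], rule subgroup.mem_carrier[OF Hs ab(2)])
  have "e [^] n = a [^] n \<otimes> b [^] n" using c by (simp add: ab(3) pow_mult_distrib m_comm)
  hence "e [^] n = b [^] n" using exp[OF ab(1)] c by simp
  moreover have "b [^] n \<in> H"
  proof (induction n)
    case 0 show ?case using Hs by (simp add: subgroup.one_closed)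
  next
    case (Suc n) thus ?case using Hs ab(2) by (simp add: subgroup.m_closed)
  qed
  ultimately show False using eN H(2) by auto
qed

text \<open>The closure assumption makes T a union of cosets of K. Counting in the quotient by K can
  thus be carried out in the group itself.\<close>

lemma (in group) card_cosets_of_union:
  assumes K: "subgroup K G" and fin: "finite (carrier G)" and T: "T \<subseteq> carrier G"
    and cl: "\<And>k t. k \<in> K \<Longrightarrow> t \<in> T \<Longrightarrow> k \<otimes> t \<in> T"
  shows "card K * card ((\<lambda>g. K #> g) ` T) = card T"
proof -
  let ?C = "(\<lambda>g. K #> g) ` T"
  have sub: "?C \<subseteq> rcosets K" using T by (auto simp: RCOSETS_def)
  have U: "\<Union>?C = T"
  proof
    show "\<Union>?C \<subseteq> T" using cl by (auto simp: r_coset_def)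
    show "T \<subseteq> \<Union>?C" using T rcos_self[OF _ K] by blast
  qed
  have finT: "finite T" using T fin by (rule finite_subset)
  have "card K * card ?C = card (\<Union>?C)"
  proof (rule card_partition)
    show "finite ?C" using finT by simp
    show "finite (\<Union>?C)" unfolding U by (rule finT)
    show "card c = card K" if "c \<in> ?C" for c
      by (rule card_rcosets_equal[OF subsetD[OF sub that] subgroup.subset[OF K], symmetric])
    show "c \<inter> d = {}" if "c \<in> ?C" "d \<in> ?C" "c \<noteq> d" for c d
      using rcos_disjoint[OF K] that sub unfolding pairwise_def disjnt_def by blast
  qed
  thus ?thesis unfolding U .
qed

text \<open>Isolates what the autocorrelation and the difference set use of an expansion: additivity
  modulo h when one argument lies in \<open>L\<close>. Values are kept as representatives in
  {0..<h}, so that congruent values are equal. Attaining the value 1 on \<open>L\<close> suffices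
  for surjectivity, by taking powers.\<close>

locale hary_quasi_hom = comm_group E for E (structure) +
  fixes h :: nat and L :: "'a set" and f :: "'a \<Rightarrow> int"
  assumes prime_h: "prime h" and fin: "finite (carrier E)" and subL: "subgroup L E"
    and f_range: "g \<in> carrier E \<Longrightarrow> f g \<in> {0..<int h}"
    and f_mult_L: "g \<in> carrier E \<Longrightarrow> l \<in> L \<Longrightarrow> [f (g \<otimes> l) = f g + f l] (mod int h)"
    and f_onto: "\<exists>l\<in>L. f l = 1"
begin

definition K where "K = {l \<in> L. f l = 0}"

lemma h_gt: "h > 1" "h > 0"
  using prime_h prime_gt_1_nat by (auto dest: prime_gt_0_nat)

lemma L_carrier: "l \<in> L \<Longrightarrow> l \<in> carrier E"
  using subL by (rule subgroup.mem_carrier)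

lemma finL: "finite L"
  using fin subL by (meson finite_subset subgroup.subset)

lemma f_eqI: "a \<in> carrier E \<Longrightarrow> b \<in> carrier E \<Longrightarrow> [f a = f b] (mod int h) \<Longrightarrow> f a = f b"
  using f_range[of a] f_range[of b] by (auto simp: cong_def)

lemma f_one: "f \<one> = 0"
proof -
  have "[f \<one> = f \<one> + f \<one>] (mod int h)"
    using f_mult_L[of \<one> \<one>] subgroup.one_closed[OF subL] by simp
  hence "int h dvd f \<one>" by (simp add: cong_iff_dvd_diff)
  thus ?thesis using f_range[of \<one>] by (auto dest: zdvd_imp_le)
qed

lemma f_inv_L:
  assumes "l \<in> L" shows "[f (inv l) = - f l] (mod int h)"
proof -
  have "[f (l \<otimes> inv l) = f l + f (inv l)] (mod int h)"
    using assms subL by (intro f_mult_L L_carrier subgroup.m_inv_closed)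
  hence "[f l + f (inv l) = 0] (mod int h)" using assms L_carrier by (simp add: f_one cong_sym)
  thus ?thesis by (simp add: cong_iff_dvd_diff add.commute)
qed

lemma L_pow: "l \<in> L \<Longrightarrow> l [^] (n::nat) \<in> L"
  by (induction n) (use subL in \<open>auto simp: subgroup.one_closed subgroup.m_closed\<close>)

lemma f_pow_L:
  assumes "l \<in> L" shows "[f (l [^] (n::nat)) = int n * f l] (mod int h)"
proof (induction n)
  case 0 thus ?case by (simp add: f_one)
next
  case (Suc n)
  have "[f (l [^] n \<otimes> l) = f (l [^] n) + f l] (mod int h)"
    using assms by (intro f_mult_L L_carrier L_pow)
  also have "[f (l [^] n) + f l = int n * f l + f l] (mod int h)"
    using Suc.IH by (rule cong_add) simp
  finally show ?case by (simp add: algebra_simps)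
qed

lemma f_onto': "j < h \<Longrightarrow> \<exists>l\<in>L. f l = int j"
proof -
  assume j: "j < h"
  obtain l where l: "l \<in> L" "f l = 1" using f_onto by blast
  have "[f (l [^] j) = int j] (mod int h)" using f_pow_L[OF l(1), of j] l(2) by simp
  hence "f (l [^] j) = int j" using f_range[OF L_carrier[OF L_pow[OF l(1), of j]]] j
    by (auto simp: cong_def)
  thus ?thesis using L_pow[OF l(1)] by blast
qed

text \<open>Translation by an element of \<open>L\<close> with f-value j carries the slice f = 0 of
  S bijectively onto the slice f = j, so the h slices have equal size.\<close>

lemma card_slices:
  assumes S: "S \<subseteq> carrier E" and cl: "\<And>w l. w \<in> S \<Longrightarrow> l \<in> L \<Longrightarrow> w \<otimes> l \<in> S"
  shows "h * card {w \<in> S. f w = 0} = card S"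
proof -
  have finS: "finite S" using S fin by (rule finite_subset)
  have slice: "card {w \<in> S. f w = int j} = card {w \<in> S. f w = 0}" if j: "j < h" for j
  proof -
    obtain l where l: "l \<in> L" "f l = int j" using f_onto'[OF j] by blast
    have il: "inv l \<in> L" using l(1) subL by (simp add: subgroup.m_inv_closed)
    have "bij_betw (\<lambda>w. w \<otimes> l) {w \<in> S. f w = 0} {w \<in> S. f w = int j}"
    proof (rule bij_betw_byWitness[where f' = "\<lambda>w. w \<otimes> inv l"])
      show "\<forall>w\<in>{w \<in> S. f w = 0}. w \<otimes> l \<otimes> inv l = w" 
        using S l L_carrier by (auto simp: m_assoc)
      show "\<forall>w\<in>{w \<in> S. f w = int j}. w \<otimes> inv l \<otimes> l = w"
        using S l L_carrier by (auto simp: m_assoc)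
      show "(\<lambda>w. w \<otimes> l) ` {w \<in> S. f w = 0} \<subseteq> {w \<in> S. f w = int j}"
      proof safe
        fix w assume w: "w \<in> S" "f w = 0"
        show "w \<otimes> l \<in> S" using cl w l by blast
        have "[f (w \<otimes> l) = f l] (mod int h)" using f_mult_L[of w l] w l S by auto
        thus "f (w \<otimes> l) = int j" using f_eqI[of "w \<otimes> l" l] w l S L_carrier by auto
      qed
      show "(\<lambda>w. w \<otimes> inv l) ` {w \<in> S. f w = int j} \<subseteq> {w \<in> S. f w = 0}"
      proof safe
        fix w assume w: "w \<in> S" "f w = int j"
        show "w \<otimes> inv l \<in> S" using cl w il by blast
        have "[f (w \<otimes> inv l) = f w + f (inv l)] (mod int h)" using f_mult_L[of w "inv l"] w il S by auto
        also have "[f w + f (inv l) = f w + - f l] (mod int h)" using f_inv_L[OF l(1)] by (intro cong_add) auto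
        finally have "[f (w \<otimes> inv l) = f \<one>] (mod int h)" using w l f_one by simp
        thus "f (w \<otimes> inv l) = 0" using f_eqI[of "w \<otimes> inv l" \<one>] w il S L_carrier f_one by auto
      qed
    qed
    thus ?thesis by (simp add: bij_betw_same_card)
  qed
  have "card S = (\<Sum>j<h. card {w \<in> S. nat (f w) = j})"
  proof -
    have "nat (f w) < h" if "w \<in> S" for w
      using f_range[OF subsetD[OF S that]] by (simp add: nat_less_iff)
    hence "(\<lambda>w. nat (f w)) ` S \<subseteq> {..<h}" by auto
    hence "(\<Sum>j<h. \<Sum>w\<in>{w \<in> S. nat (f w) = j}. 1) = (\<Sum>w\<in>S. 1::nat)"
      using finS by (intro sum.group) auto
    thus ?thesis by simp
  qed
  also have "\<dots> = (\<Sum>j<h. card {w \<in> S. f w = 0})"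
  proof (rule sum.cong[OF refl])
    fix j assume "j \<in> {..<h}"
    moreover have "nat (f w) = j \<longleftrightarrow> f w = int j" if "w \<in> S" for w
      using f_range[OF subsetD[OF S that]] by auto
    hence "{w \<in> S. nat (f w) = j} = {w \<in> S. f w = int j}" by auto
    ultimately show "card {w \<in> S. nat (f w) = j} = card {w \<in> S. f w = 0}" using slice[of j] by simp
  qed
  finally show ?thesis by simp
qed

lemma AC_mult_L:
  assumes g: "g \<in> carrier E" and l: "l \<in> L"
  shows "AC h E f (g \<otimes> l) = zeta h powi (- f l) * AC h E f g"
proof -
  have "zeta h powi (f w - f (w \<otimes> (g \<otimes> l))) = zeta h powi (- f l) * zeta h powi (f w - f (w \<otimes> g))"
    if w: "w \<in> carrier E" for w
  proof -
    have "[f (w \<otimes> g \<otimes> l) = f (w \<otimes> g) + f l] (mod int h)" using w g l by (intro f_mult_L) auto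
    hence "[f w - f (w \<otimes> (g \<otimes> l)) = f w - (f (w \<otimes> g) + f l)] (mod int h)"
      using w g l L_carrier by (intro cong_diff) (auto simp: m_assoc)
    hence "zeta h powi (f w - f (w \<otimes> (g \<otimes> l))) = zeta h powi (f w - (f (w \<otimes> g) + f l))"
      using h_gt by (intro zeta_powi_cong)
    also have "\<dots> = zeta h powi (- f l + (f w - f (w \<otimes> g)))" by (simp add: algebra_simps)
    finally show ?thesis by (subst (asm) power_int_add) auto
  qed
  thus ?thesis unfolding AC_def by (simp add: sum_distrib_left cong: sum.cong)
qed

lemma AC_on_L: "l \<in> L \<Longrightarrow> AC h E f l = of_nat (order E) * zeta h powi (- f l)"
  using AC_mult_L[of \<one> l] L_carrier by (simp add: AC_def order_def)

text \<open>The value of \<open>AC\<close> is \<open>\<Sum>\<^sub>j N\<^sub>j \<zeta>\<^sub>h\<^sup>j\<close>, where \<open>N\<^sub>j\<close> counts the \<open>w\<close> with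
  \<open>f w - f (w \<otimes> g) \<equiv> j\<close>; as \<open>h\<close> is prime, it vanishes iff all \<open>N\<^sub>j\<close> agree, and replacing \<open>g\<close>
  by its translates under \<open>L\<close> permutes the \<open>N\<^sub>j\<close> cyclically.\<close>

lemma AC_eq_0_iff_card:
  assumes g: "g \<in> carrier E"
  shows "(\<forall>l\<in>L. AC h E f (g \<otimes> l) = 0) \<longleftrightarrow>
         (\<forall>l\<in>L. h * card {w \<in> carrier E. f w = f (w \<otimes> (g \<otimes> l))} = order E)"
proof -
  define D where "D w = nat ((f w - f (w \<otimes> g)) mod int h)" for w
  define N where "N j = card {w \<in> carrier E. D w = j}" for j
  have Dr: "D ` carrier E \<subseteq> {..<h}" using h_gt by (auto simp: D_def nat_less_iff)
  have AC: "AC h E f g = (\<Sum>j<h. of_int (int (N j)) * zeta h ^ j)"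
  proof -
    have "AC h E f g = (\<Sum>w\<in>carrier E. zeta h ^ D w)"
      unfolding AC_def
    proof (rule sum.cong[OF refl])
      fix w
      have "zeta h powi (f w - f (w \<otimes> g)) = zeta h powi int (D w)"
        using h_gt by (intro zeta_powi_cong) (auto simp: D_def cong_def)
      thus "zeta h powi (f w - f (w \<otimes> g)) = zeta h ^ D w" by simp
    qed
    also have "\<dots> = (\<Sum>j<h. \<Sum>w\<in>{w \<in> carrier E. D w = j}. zeta h ^ D w)"
      using fin Dr by (intro sum.group[symmetric]) auto
    also have "\<dots> = (\<Sum>j<h. of_int (int (N j)) * zeta h ^ j)"
      by (intro sum.cong) (auto simp: N_def)
    finally show ?thesis .
  qed
  have sumN: "(\<Sum>j<h. N j) = order E"
  proof -
    have "(\<Sum>j<h. \<Sum>w\<in>{w \<in> carrier E. D w = j}. 1) = (\<Sum>w\<in>carrier E. 1::nat)"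
      using fin Dr by (intro sum.group) auto
    thus ?thesis by (simp add: N_def order_def)
  qed
  have shift: "card {w \<in> carrier E. f w = f (w \<otimes> (g \<otimes> l))} = N (nat (f l))" if l: "l \<in> L" for l
  proof -
    have "f w = f (w \<otimes> (g \<otimes> l)) \<longleftrightarrow> D w = nat (f l)" if w: "w \<in> carrier E" for w
    proof -
      have 1: "[f (w \<otimes> (g \<otimes> l)) = f (w \<otimes> g) + f l] (mod int h)"
        using f_mult_L[of "w \<otimes> g" l] w g l L_carrier by (simp add: m_assoc)
      have "f w = f (w \<otimes> (g \<otimes> l)) \<longleftrightarrow> [f w = f (w \<otimes> (g \<otimes> l))] (mod int h)"
        using f_eqI[of w "w \<otimes> (g \<otimes> l)"] w g l L_carrier by auto
      also have "\<dots> \<longleftrightarrow> [f w = f (w \<otimes> g) + f l] (mod int h)"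
        using 1 by (meson cong_sym cong_trans)
      also have "\<dots> \<longleftrightarrow> [f w - f (w \<otimes> g) = f l] (mod int h)"
        by (simp add: cong_iff_dvd_diff algebra_simps)
      also have "\<dots> \<longleftrightarrow> (f w - f (w \<otimes> g)) mod int h = f l"
        using f_range[OF L_carrier[OF l]] by (simp add: cong_def)
      also have "\<dots> \<longleftrightarrow> D w = nat (f l)"
        using f_range[OF L_carrier[OF l]] h_gt by (simp add: D_def nat_eq_iff)
      finally show ?thesis .
    qed
    thus ?thesis unfolding N_def by (intro arg_cong[where f = card]) auto
  qed
  have "(\<forall>l\<in>L. AC h E f (g \<otimes> l) = 0) \<longleftrightarrow> AC h E f g = 0"
    using AC_mult_L[OF g] subgroup.one_closed[OF subL] by (auto simp: f_one)
  also have "\<dots> \<longleftrightarrow> (\<forall>j<h. h * N j = order E)"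
  proof
    assume "AC h E f g = 0"
    hence sum0: "(\<Sum>j<h. of_int (int (N j)) * zeta h ^ j) = 0" unfolding AC .
    have eq: "N i = N j" if "i < h" "j < h" for i j
      using sum_prime_roots_eq_0_imp_const[OF prime_h sum0 that] by simp
    show "\<forall>j<h. h * N j = order E"
    proof (intro allI impI)
      fix j assume "j < h"
      hence "(\<Sum>i<h. N i) = (\<Sum>i<h. N j)" by (intro sum.cong refl eq) auto
      thus "h * N j = order E" using sumN by simp
    qed
  next
    assume N: "\<forall>j<h. h * N j = order E"
    have eq: "N j = N 0" if "j < h" for j
    proof -
      have "h * N j = h * N 0" using N that h_gt(2) by metis
      thus ?thesis using h_gt(2) by simp
    qed
    have "AC h E f g = (\<Sum>j<h. of_nat (N 0) * zeta h ^ j)"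
      unfolding AC
    proof (rule sum.cong[OF refl])
      fix j assume "j \<in> {..<h}"
      hence "N j = N 0" using eq by blast
      thus "of_int (int (N j)) * zeta h ^ j = of_nat (N 0) * zeta h ^ j" by (simp only: of_int_of_nat_eq)
    qed
    also have "\<dots> = 0" using sum_zeta_powers[of h] h_gt by (simp flip: sum_distrib_left)
    finally show "AC h E f g = 0" .
  qed
  also have "\<dots> \<longleftrightarrow> (\<forall>l\<in>L. h * N (nat (f l)) = order E)"
  proof
    show "\<forall>j<h. h * N j = order E" if "\<forall>l\<in>L. h * N (nat (f l)) = order E"
      using that f_onto' by (metis nat_int)
    show "\<forall>l\<in>L. h * N (nat (f l)) = order E" if "\<forall>j<h. h * N j = order E"
      using that f_range L_carrier by (auto simp: nat_less_iff)
  qed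
  finally show ?thesis using shift by simp
qed

text \<open>For a single g the two conditions are compared over the whole coset of \<open>L\<close>
  through g. The complement of \<open>L\<close> is a union of such cosets, so quantifying over it
  allows the comparison.\<close>

lemma AC_vanishes_iff_card:
  "(\<forall>g\<in>carrier E - L. AC h E f g = 0) \<longleftrightarrow>
   (\<forall>g\<in>carrier E - L. h * card {w \<in> carrier E. f w = f (w \<otimes> g)} = order E)"
proof -
  have inL: "g \<otimes> l \<in> carrier E - L" if "g \<in> carrier E - L" "l \<in> L" for g l
  proof -
    have "g \<in> L" if "g \<otimes> l \<in> L"
    proof -
      have "g \<otimes> l \<otimes> inv l \<in> L"
        using that subL \<open>l \<in> L\<close> by (simp add: subgroup.m_closed subgroup.m_inv_closed)
      thus ?thesis using \<open>g \<in> carrier E - L\<close> \<open>l \<in> L\<close> L_carrier by (simp add: m_assoc)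
    qed
    thus ?thesis using that L_carrier by auto
  qed
  have "(\<forall>g\<in>carrier E - L. P g) \<longleftrightarrow> (\<forall>g\<in>carrier E - L. \<forall>l\<in>L. P (g \<otimes> l))" for P
    using inL subgroup.one_closed[OF subL] by (metis DiffD1 r_one)
  from this[of "\<lambda>g. AC h E f g = 0"] this[of "\<lambda>g. h * card {w \<in> carrier E. f w = f (w \<otimes> g)} = order E"]
  show ?thesis using AC_eq_0_iff_card by simp
qed

section \<open>The quotient by the kernel and its relative difference set\<close>

lemma subK: "subgroup K E"
proof (rule subgroupI)
  show "K \<subseteq> carrier E" using L_carrier by (auto simp: K_def)
  show "K \<noteq> {}" using subgroup.one_closed[OF subL] f_one by (auto simp: K_def)
  show "inv k \<in> K" if "k \<in> K" for k
  proof -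
    have k: "k \<in> L" "f k = 0" using that by (auto simp: K_def)
    have il: "inv k \<in> L" using k subL by (simp add: subgroup.m_inv_closed)
    have "f (inv k) = f \<one>" using f_inv_L[OF k(1)] k L_carrier[OF il] by (intro f_eqI) (auto simp: f_one)
    thus ?thesis using il by (simp add: K_def f_one)
  qed
  show "a \<otimes> b \<in> K" if "a \<in> K" "b \<in> K" for a b
  proof -
    have ab: "a \<in> L" "f a = 0" "b \<in> L" "f b = 0" using that by (auto simp: K_def)
    hence "f (a \<otimes> b) = f \<one>" using f_mult_L[of a b] L_carrier by (intro f_eqI) (auto simp: f_one)
    thus ?thesis using ab subL by (simp add: K_def f_one subgroup.m_closed)
  qed
qed

lemma card_K: "h * card K = card L"
  unfolding K_def using subL by (intro card_slices) (auto intro: L_carrier subgroup.m_closed)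

lemma f_mult_K: "g \<in> carrier E \<Longrightarrow> k \<in> K \<Longrightarrow> f (k \<otimes> g) = f g"
  using f_mult_L[of g k] L_carrier[of k] by (intro f_eqI) (auto simp: K_def m_comm)

lemma rcoset_K_eq_iff:
  assumes "a \<in> carrier E" "b \<in> carrier E"
  shows "K #> a = K #> b \<longleftrightarrow> (\<exists>k\<in>K. b = k \<otimes> a)"
proof
  assume "K #> a = K #> b"
  hence "b \<in> K #> a" using assms subK repr_independenceD by blast
  thus "\<exists>k\<in>K. b = k \<otimes> a" by (auto simp: r_coset_def)
next
  assume "\<exists>k\<in>K. b = k \<otimes> a"
  hence "b \<in> K #> a" by (auto simp: r_coset_def)
  thus "K #> a = K #> b" using assms subK by (intro repr_independence)
qed

lemma rcoset_K_mult:
  "a \<in> carrier E \<Longrightarrow> b \<in> carrier E \<Longrightarrow> (K #> a) \<otimes>\<^bsub>E Mod K\<^esub> (K #> b) = K #> (a \<otimes> b)"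
  using normal.rcos_sum[OF subgroup_imp_normal[OF subK]] by simp

lemma comm_group_Mod_K: "comm_group (E Mod K)"
  using subK by (rule abelian_FactGroup)

lemma subgroup_L_Mod_K: "subgroup ((\<lambda>g. K #> g) ` L) (E Mod K)"
proof -
  have "group_hom E (E Mod K) (\<lambda>g. K #> g)"
    using comm_group_Mod_K normal.r_coset_hom_Mod[OF subgroup_imp_normal[OF subK]]
    by (simp add: group_hom_def group_hom_axioms_def comm_group_def is_group)
  thus ?thesis using subL by (rule group_hom.subgroup_img_is_subgroup)
qed

lemma card_image_K:
  assumes "T \<subseteq> carrier E" "\<And>k t. k \<in> K \<Longrightarrow> t \<in> T \<Longrightarrow> k \<otimes> t \<in> T"
  shows "card K * card ((\<lambda>g. K #> g) ` T) = card T"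
  using subK fin assms by (rule card_cosets_of_union)

lemma K_pos: "card K > 0"
  using finL subgroup.one_closed[OF subK] by (auto simp: card_gt_0_iff K_def)

lemma K_sub_L: "K \<subseteq> L"
  by (auto simp: K_def)

definition R where "R = {K #> g |g. g \<in> carrier E \<and> f g = 0}"

lemma R_image: "R = (\<lambda>g. K #> g) ` {g \<in> carrier E. f g = 0}"
  by (auto simp: R_def)

text \<open>The coset through g consists of the classes of l g with l in \<open>L\<close>, and f (l
  g) is f g + f l modulo h. Since f identifies \<open>L\<close> modulo \<open>K\<close> with Z_h,
  exactly one class has value 0. So \<open>R\<close> is a full transversal by itself.\<close>

lemma R_transversal: "is_transversal (E Mod K) ((\<lambda>g. K #> g) ` L) R"
  unfolding is_transversal_def
proof (intro conjI ballI)
  let ?q = "\<lambda>g. K #> g"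
  show "R \<subseteq> carrier (E Mod K)" by (auto simp: R_def carrier_FactGroup)
  fix C assume "C \<in> rcosets\<^bsub>E Mod K\<^esub> (?q ` L)"
  then obtain g where g: "g \<in> carrier E" "C = ?q ` L #>\<^bsub>E Mod K\<^esub> ?q g"
    by (auto simp: RCOSETS_def carrier_FactGroup)
  have "C = (\<Union>l\<in>L. {?q l \<otimes>\<^bsub>E Mod K\<^esub> ?q g})" by (auto simp: g(2) r_coset_def[of "E Mod K"])
  also have "\<dots> = (\<Union>l\<in>L. {?q (l \<otimes> g)})"
    using g L_carrier by (intro SUP_cong refl) (simp only: rcoset_K_mult)
  finally have C: "C = (\<lambda>l. ?q (l \<otimes> g)) ` L" by auto
  have f: "[f (l \<otimes> g) = f g + f l] (mod int h)" if "l \<in> L" for l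
    using f_mult_L[OF g(1) that] that L_carrier g(1) by (simp add: m_comm)
  show "\<exists>!t. t \<in> R \<inter> C"
  proof (rule ex_ex1I)
    have "nat ((- f g) mod int h) < h" using h_gt by (simp add: nat_less_iff)
    then obtain l where l: "l \<in> L" "f l = (- f g) mod int h" using f_onto' h_gt by fastforce
    have lg: "l \<otimes> g \<in> carrier E" using g(1) L_carrier[OF l(1)] by simp
    have "[f (l \<otimes> g) = f \<one>] (mod int h)"
      using f[OF l(1)] unfolding l(2) f_one by (simp add: cong_def mod_add_right_eq)
    hence "f (l \<otimes> g) = 0" using f_eqI[OF lg one_closed] f_one by simp
    hence "?q (l \<otimes> g) \<in> R" unfolding R_def using lg by blast
    moreover have "?q (l \<otimes> g) \<in> C" unfolding C using l(1) by blast
    ultimately show "\<exists>t. t \<in> R \<inter> C" by blast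
  next
    fix s t assume st: "s \<in> R \<inter> C" "t \<in> R \<inter> C"
    have *: "\<exists>l\<in>L. s = ?q (l \<otimes> g) \<and> f (l \<otimes> g) = 0" if "s \<in> R \<inter> C" for s
    proof -
      obtain l where l: "l \<in> L" "s = ?q (l \<otimes> g)" using \<open>s \<in> R \<inter> C\<close> by (auto simp: C)
      obtain w where w: "w \<in> carrier E" "s = ?q w" "f w = 0" using \<open>s \<in> R \<inter> C\<close> by (auto simp: R_def)
      have "l \<otimes> g \<in> carrier E" using l g L_carrier by simp
      then obtain k where "k \<in> K" "l \<otimes> g = k \<otimes> w" using rcoset_K_eq_iff[of w "l \<otimes> g"] w l by auto
      hence "f (l \<otimes> g) = 0" using f_mult_K w by simp
      thus ?thesis using l by blast
    qed
    obtain l l' where l: "l \<in> L" "s = ?q (l \<otimes> g)" "f (l \<otimes> g) = 0"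
      and l': "l' \<in> L" "t = ?q (l' \<otimes> g)" "f (l' \<otimes> g) = 0" using *[OF st(1)] *[OF st(2)] by blast
    have 0: "[f g + f l = 0] (mod int h)" "[f g + f l' = 0] (mod int h)"
      using f[OF l(1)] f[OF l'(1)] l(3) l'(3) by (simp_all add: cong_sym)
    have ill: "inv l \<in> L" "l' \<otimes> inv l \<in> L"
      using l l' subL by (simp_all add: subgroup.m_closed subgroup.m_inv_closed)
    have "[f (l' \<otimes> inv l) = f l' + f (inv l)] (mod int h)" using l l' ill L_carrier by (intro f_mult_L) auto
    also have "[f l' + f (inv l) = f l' + - f l] (mod int h)" using f_inv_L[OF l(1)] by (intro cong_add) auto
    also have "[f l' + - f l = 0] (mod int h)"
      using cong_diff[OF 0(2) 0(1)] by (simp add: algebra_simps)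
    finally have "f (l' \<otimes> inv l) = f \<one>" using ill L_carrier by (intro f_eqI) (auto simp: f_one)
    hence "l' \<otimes> inv l \<in> K" using ill by (simp add: K_def f_one)
    moreover have "l' \<otimes> g = (l' \<otimes> inv l) \<otimes> (l \<otimes> g)"
      using l l' g L_carrier by (simp add: m_assoc inv_solve_left' flip: m_assoc[of "inv l" l g])
    ultimately show "s = t"
      using l l' g L_carrier rcoset_K_eq_iff[of "l \<otimes> g" "l' \<otimes> g"] by auto
  qed
qed

text \<open>The class of w lies in \<open>R\<close> and in the translate by g iff f vanishes at w
  and at w g^-1. This system is invariant under \<open>K\<close>, which accounts for the factor |K|.
  Relaxing it to equality of the two values gives a set invariant under \<open>L\<close>, of which
  the original system is one slice out of h.\<close>

lemma card_R_inter_translate: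
  assumes g: "g \<in> carrier E"
  shows "h * card K * card (R \<inter> ((K #> g) <#\<^bsub>E Mod K\<^esub> R)) = card {w \<in> carrier E. f w = f (w \<otimes> inv g)}"
proof -
  let ?q = "\<lambda>g. K #> g" and ?S = "{w \<in> carrier E. f w = f (w \<otimes> inv g)}"
  let ?T = "{w \<in> carrier E. f w = 0 \<and> f (w \<otimes> inv g) = 0}"
  have trans: "?q g <#\<^bsub>E Mod K\<^esub> R = (\<lambda>r. ?q (g \<otimes> r)) ` {r \<in> carrier E. f r = 0}"
    using g by (auto simp: l_coset_def R_def rcoset_K_mult simp del: mult_FactGroup)
  have "R \<inter> (?q g <#\<^bsub>E Mod K\<^esub> R) = ?q ` ?T"
  proof (intro equalityI subsetI)
    fix X assume "X \<in> R \<inter> (?q g <#\<^bsub>E Mod K\<^esub> R)"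
    then obtain w r where w: "w \<in> carrier E" "f w = 0" "X = ?q w"
      and r: "r \<in> carrier E" "f r = 0" "X = ?q (g \<otimes> r)" unfolding trans by (auto simp: R_def)
    then obtain k where k: "k \<in> K" "w = k \<otimes> (g \<otimes> r)" using rcoset_K_eq_iff[of "g \<otimes> r" w] g by auto
    have kc: "k \<in> carrier E" using k K_sub_L L_carrier by blast
    have "w = (k \<otimes> r) \<otimes> g" using kc g r by (simp add: k(2) m_ac)
    hence "w \<otimes> inv g = k \<otimes> r" using kc g r by (simp add: m_assoc)
    hence "f (w \<otimes> inv g) = 0" using f_mult_K k r by simp
    thus "X \<in> ?q ` ?T" using w by blast
  next
    fix X assume "X \<in> ?q ` ?T"
    then obtain w where w: "w \<in> carrier E" "f w = 0" "f (w \<otimes> inv g) = 0" "X = ?q w" by blast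
    have "g \<otimes> (w \<otimes> inv g) = (w \<otimes> inv g) \<otimes> g" using w g by (intro m_comm) auto
    hence "X = ?q (g \<otimes> (w \<otimes> inv g))" using w g by (simp add: m_assoc)
    moreover have "w \<otimes> inv g \<in> {r \<in> carrier E. f r = 0}" using w g by simp
    ultimately have "X \<in> (\<lambda>r. ?q (g \<otimes> r)) ` {r \<in> carrier E. f r = 0}" by (rule image_eqI)
    moreover have "X \<in> R" using w unfolding R_def by blast
    ultimately show "X \<in> R \<inter> (?q g <#\<^bsub>E Mod K\<^esub> R)" unfolding trans by blast
  qed
  moreover have "card K * card (?q ` ?T) = card ?T"
  proof (rule card_image_K)
    fix k t assume k: "k \<in> K" and t: "t \<in> ?T"
    have "k \<in> carrier E" using k K_sub_L L_carrier by blast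
    thus "k \<otimes> t \<in> ?T" using t k g f_mult_K[of t k] f_mult_K[of "t \<otimes> inv g" k] by (auto simp: m_assoc)
  qed auto
  \<comment> \<open>Multiplying w by l in \<open>L\<close> adds f l to both values that are
    compared, so \<open>?S\<close> is a union of cosets of \<open>L\<close>.\<close>
  moreover have "h * card {w \<in> ?S. f w = 0} = card ?S"
  proof (rule card_slices)
    fix w l assume w: "w \<in> ?S" and l: "l \<in> L"
    have lc: "l \<in> carrier E" using l L_carrier by blast
    have "[f (w \<otimes> l) = f w + f l] (mod int h)" using w l by (intro f_mult_L) auto
    moreover have "[f (w \<otimes> l \<otimes> inv g) = f (w \<otimes> inv g) + f l] (mod int h)"
      using f_mult_L[of "w \<otimes> inv g" l] w l g lc by (simp add: m_ac)
    ultimately have "[f (w \<otimes> l) = f (w \<otimes> l \<otimes> inv g)] (mod int h)"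
      using w by (metis (mono_tags, lifting) cong_sym cong_trans mem_Collect_eq)
    thus "w \<otimes> l \<in> ?S" using w lc g f_eqI[of "w \<otimes> l" "w \<otimes> l \<otimes> inv g"] by auto
  qed auto
  moreover have "{w \<in> ?S. f w = 0} = ?T" by auto
  ultimately show ?thesis by (simp add: mult.assoc)
qed

text \<open>Sizes, normality and the transversal hold for every such f, so the intersection numbers
  carry the whole content. An intersection number c equals v/h iff h c = v, and scaling by h |K| =
  |L| turns this into the count against |E| = v |L|.\<close>

theorem is_RDS_iff:
  assumes v: "order E = v * card L" "h dvd v"
  shows "is_RDS (E Mod K) ((\<lambda>g. K #> g) ` L) v h v (v div h) R \<longleftrightarrow>
         (\<forall>g\<in>carrier E - L. AC h E f g = 0)"
proof -
  let ?q = "\<lambda>g. K #> g" and ?Q = "E Mod K"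
  interpret Q: comm_group ?Q by (rule comm_group_Mod_K)
  have carQ: "carrier ?Q = ?q ` carrier E" by (auto simp: carrier_FactGroup)
  have finQ: "finite (carrier ?Q)" using fin by (simp add: carQ)
  have N: "?q ` L \<lhd> ?Q" using subgroup_L_Mod_K by (rule Q.subgroup_imp_normal)
  have "card K * card (?q ` L) = h * card K"
    unfolding card_K using subL K_sub_L by (intro card_image_K) (auto intro: L_carrier subgroup.m_closed)
  hence cN: "card (?q ` L) = h" using K_pos by simp
  have "card K * order ?Q = order E"
    unfolding order_def carQ using subgroup.subset[OF subK] by (intro card_image_K) auto
  also have "\<dots> = card K * (h * v)" by (simp add: v(1) card_K[symmetric] mult_ac)
  finally have ordQ: "order ?Q = h * v" using K_pos by simp
  have cosets: "card (rcosets\<^bsub>?Q\<^esub> (?q ` L)) = v"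
    using Q.lagrange[OF subgroup_L_Mod_K] cN ordQ h_gt by simp
  have "card K * card R = card {g \<in> carrier E. f g = 0}"
    unfolding R_image using f_mult_K K_sub_L L_carrier by (intro card_image_K) auto
  moreover have "h * card {g \<in> carrier E. f g = 0} = card K * (h * v)"
    using card_slices[of "carrier E"] L_carrier v(1) by (simp add: order_def card_K[symmetric] mult_ac)
  ultimately have "h * (card K * card R) = h * (card K * v)" by (simp add: mult_ac)
  hence cR: "card R = v" using h_gt K_pos by simp
  have "is_RDS ?Q (?q ` L) v h v (v div h) R \<longleftrightarrow>
      (\<forall>x\<in>carrier ?Q - ?q ` L. card (R \<inter> (x <#\<^bsub>?Q\<^esub> R)) = v div h)"
    unfolding is_RDS_def using R_transversal finQ N cN cosets cR Q.is_group by blast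
  also have "\<dots> \<longleftrightarrow> (\<forall>g\<in>carrier E - L. card (R \<inter> (?q g <#\<^bsub>?Q\<^esub> R)) = v div h)"
  proof -
    have "?q g \<in> ?q ` L \<longleftrightarrow> g \<in> L" if g: "g \<in> carrier E" for g
    proof
      assume "?q g \<in> ?q ` L"
      then obtain l where l: "l \<in> L" "?q l = ?q g" by auto
      then obtain k where "k \<in> K" "g = k \<otimes> l"
        using rcoset_K_eq_iff[OF L_carrier[OF l(1)] g] by blast
      thus "g \<in> L" using l K_sub_L subL by (auto intro: subgroup.m_closed)
    qed auto
    hence "carrier ?Q - ?q ` L = ?q ` (carrier E - L)" unfolding carQ by auto
    thus ?thesis by simp
  qed
  also have "\<dots> \<longleftrightarrow> (\<forall>g\<in>carrier E - L. h * card {w \<in> carrier E. f w = f (w \<otimes> inv g)} = order E)"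
  proof (intro ball_cong refl)
    fix g assume g: "g \<in> carrier E - L"
    let ?c = "card (R \<inter> (?q g <#\<^bsub>?Q\<^esub> R))"
    have hv: "h * (v div h) = v" using v(2) by simp
    have "?c = v div h \<longleftrightarrow> h * ?c = v" using hv h_gt by (metis mult_left_cancel neq0_conv)
    also have "\<dots> \<longleftrightarrow> (h * card K) * (h * ?c) = (h * card K) * v" using K_pos h_gt by simp
    also have "\<dots> \<longleftrightarrow> h * (h * card K * ?c) = order E" by (simp add: v(1) card_K[symmetric] mult_ac)
    finally show "?c = v div h \<longleftrightarrow> h * card {w \<in> carrier E. f w = f (w \<otimes> inv g)} = order E"
      using card_R_inter_translate[of g] g by simp
  qed
  \<comment> \<open>Inversion permutes the complement of \<open>L\<close>, which removes the inverse
    produced by translating \<open>R\<close>.\<close>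
  also have "\<dots> \<longleftrightarrow> (\<forall>g\<in>carrier E - L. h * card {w \<in> carrier E. f w = f (w \<otimes> g)} = order E)"
  proof -
    have inv: "inv g \<in> carrier E - L" if g: "g \<in> carrier E - L" for g
    proof -
      have "inv (inv g) \<in> L" if "inv g \<in> L" using subL that by (rule subgroup.m_inv_closed)
      thus ?thesis using g by auto
    qed
    have "(\<forall>g\<in>carrier E - L. P (inv g)) \<longleftrightarrow> (\<forall>g\<in>carrier E - L. P g)" for P
    proof
      assume P: "\<forall>g\<in>carrier E - L. P (inv g)"
      show "\<forall>g\<in>carrier E - L. P g"
      proof
        fix g assume g: "g \<in> carrier E - L"
        hence "P (inv (inv g))" using P inv by blast
        thus "P g" using g by simp
      qed
    qed (use inv in blast)
    thus ?thesis .
  qed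
  finally show ?thesis unfolding AC_vanishes_iff_card .
qed

text \<open>A complement of \<open>L/K\<close> would force the \<open>n\<close>-th power of \<open>e K\<close> to be trivial.\<close>

lemma not_direct_factor_L_Mod_K:
  assumes e: "e \<in> carrier E" "e [^] n \<in> L" "f (e [^] n) \<noteq> 0" and n: "h dvd n"
  shows "\<not> direct_factor (E Mod K) ((\<lambda>g. K #> g) ` L)"
proof -
  let ?q = "\<lambda>g. K #> g" and ?Q = "E Mod K"
  interpret Q: comm_group ?Q by (rule comm_group_Mod_K)
  have pow: "?q a [^]\<^bsub>?Q\<^esub> k = ?q (a [^] k)" if "a \<in> carrier E" for a and k :: nat
  proof (induction k)
    case 0 show ?case using coset_mult_one[OF subgroup.subset[OF subK]] by simp
  next
    case (Suc k) thus ?case using that by (simp add: rcoset_K_mult del: mult_FactGroup)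
  qed
  show ?thesis
  proof (rule Q.not_direct_factor_if_power)
    show "subgroup (?q ` L) ?Q" by (rule subgroup_L_Mod_K)
    show "?q e \<in> carrier ?Q" using e by (auto simp: carrier_FactGroup)
    show "?q e [^]\<^bsub>?Q\<^esub> n \<in> ?q ` L" using e pow by auto
    have "?q (e [^] n) \<noteq> K"
    proof
      assume "?q (e [^] n) = K"
      hence "e [^] n \<in> K" using e subK coset_join1 by simp
      thus False using e by (simp add: K_def)
    qed
    thus "?q e [^]\<^bsub>?Q\<^esub> n \<noteq> \<one>\<^bsub>?Q\<^esub>" using e pow by simp
    fix x assume "x \<in> ?q ` L"
    then obtain l where l: "l \<in> L" "x = ?q l" by blast
    have "[f (l [^] n) = int n * f l] (mod int h)" by (rule f_pow_L[OF l(1)])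
    also have "[int n * f l = f \<one>] (mod int h)" using n by (simp add: f_one cong_0_iff)
    finally have "f (l [^] n) = f \<one>" using L_carrier[OF l(1)] by (intro f_eqI) auto
    hence "l [^] n \<in> K" using L_pow[OF l(1)] by (simp add: K_def f_one)
    hence "?q (l [^] n) = K" using L_carrier[OF l(1)] subK by (intro coset_join2) auto
    thus "x [^]\<^bsub>?Q\<^esub> n = \<one>\<^bsub>?Q\<^esub>" using pow[OF L_carrier[OF l(1)]] l by simp
  qed
qed

end

subsection \<open>Orthogonal cocycles\<close>

lemma norm_unity_roots: "u \<in> unity_roots h \<Longrightarrow> cmod u = 1"
  by (auto simp: unity_roots_def zeta_cis norm_power)

lemma mult_cnj_unity_roots: "u \<in> unity_roots h \<Longrightarrow> u * cnj u = 1"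
  using norm_unity_roots[of u h] by (simp add: complex_norm_square[symmetric])

lemma (in group) elem_enum_bij:
  assumes "finite (carrier G)" shows "bij_betw (elem_enum G) {..<order G} (carrier G)"
proof -
  have "\<exists>e. bij_betw e {..<order G} (carrier G)"
    using ex_bij_betw_nat_finite[OF assms] by (simp add: order_def lessThan_atLeast0)
  thus ?thesis unfolding elem_enum_def by (rule someI_ex)
qed

lemma mat_mult_adjoint_index:
  assumes M: "M \<in> carrier_mat n n" and ij: "i < n" "j < n"
  shows "(M * mat_adjoint M) $$ (i, j) = (\<Sum>k<n. M $$ (i, k) * cnj (M $$ (j, k)))"
proof -
  have d: "dim_row M = n" "dim_col M = n" using M by auto
  have A: "mat_adjoint M \<in> carrier_mat n n"
    unfolding mat_adjoint_def using d by auto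
  have a: "mat_adjoint M $$ (k, j) = cnj (M $$ (j, k))" if "k < n" for k
    unfolding mat_adjoint_def using d ij that by (simp add: mat_of_rows_def)
  have "(M * mat_adjoint M) $$ (i, j) = row M i \<bullet> col (mat_adjoint M) j"
    using d A ij by simp
  also have "\<dots> = (\<Sum>k<n. M $$ (i, k) * mat_adjoint M $$ (k, j))"
    using d A ij by (simp add: scalar_prod_def lessThan_atLeast0)
  also have "\<dots> = (\<Sum>k<n. M $$ (i, k) * cnj (M $$ (j, k)))"
    using a by (intro sum.cong) auto
  finally show ?thesis .
qed

lemma cocycle_mult_cnj:
  assumes "\<psi> \<in> cocycles G h" "a \<in> carrier G" "b \<in> carrier G"
  shows "\<psi> a b * cnj (\<psi> a b) = 1"
proof (rule mult_cnj_unity_roots)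
  show "\<psi> a b \<in> unity_roots h" using assms by (simp add: cocycles_def)
qed

text \<open>The cocycle identity for the triple (a b^-1, b, c), divided by unimodular values, turns
  each summand into a fixed factor times the entry of row a b^-1 at b c. Reindexing c then reduces
  two rows to the sum of one.\<close>

lemma (in group) cocycle_rows_inner_product:
  assumes psi: "\<psi> \<in> cocycles G h" and ab: "a \<in> carrier G" "b \<in> carrier G"
  shows "(\<Sum>c\<in>carrier G. \<psi> a c * cnj (\<psi> b c)) =
         cnj (\<psi> (a \<otimes> inv b) b) * (\<Sum>c\<in>carrier G. \<psi> (a \<otimes> inv b) c)"
proof -
  let ?d = "a \<otimes> inv b"
  have d: "?d \<in> carrier G" "?d \<otimes> b = a" using ab by (auto simp: m_assoc)
  have "\<psi> a c * cnj (\<psi> b c) = cnj (\<psi> ?d b) * \<psi> ?d (b \<otimes> c)" if c: "c \<in> carrier G" for c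
  proof -
    have "\<forall>x\<in>carrier G. \<forall>y\<in>carrier G. \<forall>z\<in>carrier G. \<psi> x y * \<psi> (x \<otimes> y) z = \<psi> x (y \<otimes> z) * \<psi> y z"
      using psi by (simp add: cocycles_def)
    hence "\<psi> ?d b * \<psi> (?d \<otimes> b) c = \<psi> ?d (b \<otimes> c) * \<psi> b c" using d(1) ab(2) c by blast
    hence eq: "\<psi> ?d b * \<psi> a c = \<psi> ?d (b \<otimes> c) * \<psi> b c" unfolding d(2) .
    have 1: "\<psi> ?d b * cnj (\<psi> ?d b) = 1" "\<psi> b c * cnj (\<psi> b c) = 1"
      by (rule cocycle_mult_cnj[OF psi d(1) ab(2)], rule cocycle_mult_cnj[OF psi ab(2) c])
    have "\<psi> a c * cnj (\<psi> b c) = (\<psi> ?d b * cnj (\<psi> ?d b)) * \<psi> a c * cnj (\<psi> b c)" by (simp add: 1)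
    also have "\<dots> = cnj (\<psi> ?d b) * (\<psi> ?d b * \<psi> a c) * cnj (\<psi> b c)" by (simp add: mult_ac)
    also have "\<dots> = cnj (\<psi> ?d b) * \<psi> ?d (b \<otimes> c) * (\<psi> b c * cnj (\<psi> b c))"
      unfolding eq by (simp add: mult_ac)
    finally show ?thesis by (simp add: 1)
  qed
  hence "(\<Sum>c\<in>carrier G. \<psi> a c * cnj (\<psi> b c)) =
      cnj (\<psi> ?d b) * (\<Sum>c\<in>carrier G. \<psi> ?d (b \<otimes> c))"
    by (simp add: sum_distrib_left)
  also have "(\<Sum>c\<in>carrier G. \<psi> ?d (b \<otimes> c)) = (\<Sum>c\<in>carrier G. \<psi> ?d c)"
    using ab(2) by (intro sum.reindex_bij_betw bij_betw_byWitness[where f' = "\<lambda>c. inv b \<otimes> c"])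
      (auto simp: m_assoc[symmetric])
  finally show ?thesis .
qed

text \<open>Pairing row a with the row of the identity gives the sum of row a up to a unimodular
  factor; conversely distinct rows a and b pair to the sum of row a b^-1, which is not the row of
  the identity. Diagonal entries are |G| by unimodularity.\<close>

lemma (in group) cocycle_mat_BH_iff:
  assumes fin: "finite (carrier G)" and psi: "\<psi> \<in> cocycles G h"
  shows "cocycle_mat G \<psi> \<in> BH (order G) h \<longleftrightarrow>
         (\<forall>a\<in>carrier G - {\<one>}. (\<Sum>c\<in>carrier G. \<psi> a c) = 0)"
proof -
  let ?n = "order G" and ?e = "elem_enum G" and ?M = "cocycle_mat G \<psi>"
  let ?ip = "\<lambda>a b. \<Sum>c\<in>carrier G. \<psi> a c * cnj (\<psi> b c)"
  have e: "bij_betw ?e {..<?n} (carrier G)" using fin by (rule elem_enum_bij)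
  have eG: "?e i \<in> carrier G" if "i < ?n" for i using e that by (auto simp: bij_betw_def)
  have inj: "?e i = ?e j \<longleftrightarrow> i = j" if "i < ?n" "j < ?n" for i j
    using e that by (auto simp: bij_betw_def inj_on_def)
  have M: "?M \<in> carrier_mat ?n ?n" by (simp add: cocycle_mat_def)
  have el: "elements_mat ?M \<subseteq> unity_roots h"
    using psi eG by (auto simp: cocycle_mat_def elements_mat_def cocycles_def)
  have ip: "(?M * mat_adjoint ?M) $$ (i, j) = ?ip (?e i) (?e j)" if "i < ?n" "j < ?n" for i j
  proof -
    have "(?M * mat_adjoint ?M) $$ (i, j) = (\<Sum>k<?n. \<psi> (?e i) (?e k) * cnj (\<psi> (?e j) (?e k)))"
      using that by (simp add: mat_mult_adjoint_index[OF M]) (simp add: cocycle_mat_def)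
    also have "\<dots> = ?ip (?e i) (?e j)" by (rule sum.reindex_bij_betw[OF e])
    finally show ?thesis .
  qed
  have diag: "?ip a a = of_nat ?n" if "a \<in> carrier G" for a
  proof -
    have "\<psi> a c * cnj (\<psi> a c) = 1" if "c \<in> carrier G" for c
      by (rule cocycle_mult_cnj[OF psi \<open>a \<in> carrier G\<close> that])
    thus ?thesis by (simp add: order_def)
  qed
  have "?M \<in> BH ?n h \<longleftrightarrow> ?M * mat_adjoint ?M = of_nat ?n \<cdot>\<^sub>m 1\<^sub>m ?n"
    using M el by (simp add: BH_def)
  also have "\<dots> \<longleftrightarrow> (\<forall>i<?n. \<forall>j<?n. ?ip (?e i) (?e j) = (if i = j then of_nat ?n else 0))"
  proof -
    define A where "A = ?M * mat_adjoint ?M"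
    have d: "dim_row A = ?n" "dim_col A = ?n" using M by (auto simp: mat_adjoint_def A_def)
    have ip: "A $$ (i, j) = ?ip (?e i) (?e j)" if "i < ?n" "j < ?n" for i j
      unfolding A_def using that by (rule ip)
    have "A = of_nat ?n \<cdot>\<^sub>m 1\<^sub>m ?n \<longleftrightarrow>
        (\<forall>i<?n. \<forall>j<?n. A $$ (i, j) = (if i = j then of_nat ?n else 0))"
      by (auto simp: mat_eq_iff d)
    thus ?thesis unfolding A_def[symmetric] by (simp add: ip)
  qed
  also have "\<dots> \<longleftrightarrow> (\<forall>a\<in>carrier G. \<forall>b\<in>carrier G. a \<noteq> b \<longrightarrow> ?ip a b = 0)" (is "?l \<longleftrightarrow> ?r")
  proof
    assume l: ?l
    show ?r
    proof (intro ballI impI)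
      fix a b assume ab: "a \<in> carrier G" "b \<in> carrier G" "a \<noteq> b"
      have "carrier G = ?e ` {..<?n}" using e by (simp add: bij_betw_def)
      then obtain i j where "i < ?n" "j < ?n" "a = ?e i" "b = ?e j" using ab by auto
      thus "?ip a b = 0" using l ab by auto
    qed
  next
    assume r: ?r thus ?l using eG inj diag by simp
  qed
  also have "\<dots> \<longleftrightarrow> (\<forall>a\<in>carrier G - {\<one>}. (\<Sum>c\<in>carrier G. \<psi> a c) = 0)" (is "_ \<longleftrightarrow> ?r'")
  proof
    assume r: ?r
    show ?r'
    proof
      fix a assume a: "a \<in> carrier G - {\<one>}"
      hence "?ip a \<one> = 0" using r by blast
      moreover have "?ip a \<one> = cnj (\<psi> a \<one>) * (\<Sum>c\<in>carrier G. \<psi> a c)"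
        using cocycle_rows_inner_product[OF psi, of a \<one>] a by simp
      moreover have "\<psi> a \<one> * cnj (\<psi> a \<one>) = 1"
        using a by (intro cocycle_mult_cnj[OF psi]) auto
      hence "cnj (\<psi> a \<one>) \<noteq> 0" by auto
      ultimately show "(\<Sum>c\<in>carrier G. \<psi> a c) = 0" by simp
    qed
  next
    assume r': ?r'
    show ?r
    proof (intro ballI impI)
      fix a b assume ab: "a \<in> carrier G" "b \<in> carrier G" "a \<noteq> b"
      hence "a \<otimes> inv b \<in> carrier G - {\<one>}" using inv_equality[of a "inv b"] by auto
      thus "?ip a b = 0" using r' ab cocycle_rows_inner_product[OF psi, of a b] by simp
    qed
  qed
  finally show ?thesis .
qed

lemma (in group) symmetric_cocycleI:
  assumes fin: "finite (carrier G)" and "\<psi> \<in> cocycles G h"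
    and "\<And>a b. a \<in> carrier G \<Longrightarrow> b \<in> carrier G \<Longrightarrow> \<psi> a b = \<psi> b a"
  shows "symmetric_cocycle G h \<psi>"
proof -
  have "elem_enum G i \<in> carrier G" if "i < order G" for i
    using elem_enum_bij[OF fin] that by (auto simp: bij_betw_def)
  thus ?thesis using assms unfolding symmetric_cocycle_def cocycle_mat_def
    by (auto intro!: eq_matI)
qed

text \<open>The cocycle identity is asked of the integer exponents themselves, as carries and
  coboundaries satisfy it exactly; the modulus enters through the normalization.\<close>

lemma cocycles_zeta_powiI:
  assumes "h > 0"
    and "\<And>a b c. a \<in> carrier G \<Longrightarrow> b \<in> carrier G \<Longrightarrow> c \<in> carrier G \<Longrightarrow>
      e a b + e (a \<otimes>\<^bsub>G\<^esub> b) c = e a (b \<otimes>\<^bsub>G\<^esub> c) + e b c"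
    and "[e \<one>\<^bsub>G\<^esub> \<one>\<^bsub>G\<^esub> = 0] (mod int h)"
  shows "(\<lambda>a b. zeta h powi e a b) \<in> cocycles G h"
  using assms zeta_powi_cong[OF assms(3,1)]
  by (auto simp: cocycles_def zeta_powi_in_unity_roots simp flip: power_int_add)

subsection \<open>Expansions of arrays\<close>

lemma mult_cyc_prod: "x \<otimes>\<^bsub>cyc_prod m t\<^esub> y = (\<lambda>i\<in>{1..m}. (x i + y i) mod int (t i))"
  by (simp add: cyc_prod_def)

lemma one_cyc_prod: "\<one>\<^bsub>cyc_prod m t\<^esub> = (\<lambda>i\<in>{1..m}. 0)"
  by (simp add: cyc_prod_def)

lemma carrier_cyc_prod:
  assumes "\<And>i. i \<in> {1..m} \<Longrightarrow> t i > 0"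
  shows "carrier (cyc_prod m t) = (\<Pi>\<^sub>E i\<in>{1..m}. {0..<int (t i)})"
  unfolding cyc_prod_def carrier_product_group
proof (rule PiE_cong)
  fix i assume "i \<in> {1..m}"
  hence "t i > 0" by (rule assms)
  thus "carrier (integer_mod_group (t i)) = {0..<int (t i)}" by (simp add: carrier_integer_mod_group)
qed

lemma comm_group_cyc_prod: "comm_group (cyc_prod m t)"
proof -
  have "group (cyc_prod m t)" by (simp add: cyc_prod_def)
  thus ?thesis by (rule group.group_comm_groupI) (simp add: mult_cyc_prod add.commute)
qed

lemma cyc_prod_cong: "(\<And>i. i \<in> {1..m} \<Longrightarrow> s i = t i) \<Longrightarrow> cyc_prod m s = cyc_prod m t"
  by (auto simp: cyc_prod_def product_group_def fun_eq_iff restrict_def intro!: PiE_cong)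

lemma pow_cyc_prod:
  assumes "x \<in> carrier (cyc_prod m t)"
  shows "x [^]\<^bsub>cyc_prod m t\<^esub> (n::nat) = (\<lambda>i\<in>{1..m}. (int n * x i) mod int (t i))"
proof (induction n)
  case 0 show ?case by (simp add: one_cyc_prod)
next
  case (Suc n) thus ?case
    by (auto simp: mult_cyc_prod fun_eq_iff restrict_def mod_add_right_eq algebra_simps)
qed

lemma order_cyc_prod:
  assumes "\<And>i. i \<in> {1..m} \<Longrightarrow> t i > 0"
  shows "order (cyc_prod m t) = (\<Prod>i\<in>{1..m}. t i)"
proof -
  have "carrier (cyc_prod m t) = (\<Pi>\<^sub>E i\<in>{1..m}. {0..<int (t i)})"
    using assms by (rule carrier_cyc_prod)
  thus ?thesis by (simp add: order_def card_PiE)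
qed

lemma finite_cyc_prod:
  assumes "\<And>i. i \<in> {1..m} \<Longrightarrow> t i > 0"
  shows "finite (carrier (cyc_prod m t))"
proof -
  have "carrier (cyc_prod m t) = (\<Pi>\<^sub>E i\<in>{1..m}. {0..<int (t i)})"
    using assms by (rule carrier_cyc_prod)
  thus ?thesis by (simp add: finite_PiE)
qed

locale hary_array =
  fixes h q m :: nat and z :: "nat \<Rightarrow> nat" and \<phi> :: "(nat \<Rightarrow> int) \<Rightarrow> int"
  assumes prime_h: "prime h" and h_dvd_q: "h dvd q" and q_gt: "q > 1"
    and phi_range: "hary_map h (cyc_pow q m) \<phi>"
    and phi_one: "\<phi> \<one>\<^bsub>cyc_pow q m\<^esub> = 0"
    and z_range: "z \<in> {1..m} \<rightarrow> {0, 1}"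
    and z_nonzero: "\<exists>i\<in>{1..m}. z i \<noteq> 0"
begin

abbreviation "s \<equiv> \<lambda>_::nat. q"
abbreviation "G \<equiv> cyc_pow q m"
abbreviation "E \<equiv> exp_group h m s z"
abbreviation "L \<equiv> L_sub h m s z"
abbreviation "f \<equiv> expansion h m s \<phi>"

definition t where "t i = (z i * (h - 1) + 1) * q"
definition J where "J = {i \<in> {1..m}. z i = 1}"
text \<open>The projection of \<open>E\<close> onto \<open>G\<close> with kernel \<open>L\<close>.
  Tuples of \<open>G\<close> are also tuples of \<open>E\<close>, so \<open>G\<close> is a section
  of it, though not a subgroup of \<open>E\<close>.\<close>

definition red where "red x = (\<lambda>i\<in>{1..m}. x i mod int q)"
definition \<psi> where "\<psi> x y = mu_cocycle h m s z x y * coboundary h G \<phi> x y"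

lemma h_pos: "h > 0" "h > 1"
  using prime_h by (auto dest: prime_gt_0_nat prime_gt_1_nat)

lemma q_pos: "q > 0"
  using q_gt by simp

lemma J_sub: "J \<subseteq> {1..m}" and finJ [simp]: "finite J"
  by (auto simp: J_def)

lemma z_cases: "i \<in> {1..m} \<Longrightarrow> z i = 0 \<or> z i = 1"
  using z_range by auto

lemma t_J: "i \<in> J \<Longrightarrow> t i = h * q"
  using h_pos by (simp add: t_def J_def)

lemma t_not_J: "i \<in> {1..m} - J \<Longrightarrow> t i = q"
  using z_cases[of i] by (auto simp: t_def J_def)

lemma t_pos: "i \<in> {1..m} \<Longrightarrow> t i > 0"
  using q_gt by (simp add: t_def)

lemma q_dvd_t: "int q dvd int (t i)"
  by (simp add: t_def)

lemma q_le_t: "q \<le> t i"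
  by (simp add: t_def)

lemma E_eq: "E = cyc_prod m t"
  by (simp add: exp_group_def t_def fun_eq_iff cong: cyc_prod_cong)

lemma carrier_E: "carrier E = (\<Pi>\<^sub>E i\<in>{1..m}. {0..<int (t i)})"
  unfolding E_eq by (rule carrier_cyc_prod[OF t_pos])

lemma carrier_G: "carrier G = (\<Pi>\<^sub>E i\<in>{1..m}. {0..<int q})"
  by (rule carrier_cyc_prod) (rule q_pos)

sublocale G: comm_group G
  by (rule comm_group_cyc_prod)

sublocale E: comm_group E
  unfolding E_eq by (rule comm_group_cyc_prod)

lemma mult_E: "x \<otimes>\<^bsub>E\<^esub> y = (\<lambda>i\<in>{1..m}. (x i + y i) mod int (t i))"
  unfolding E_eq by (rule mult_cyc_prod)

lemma fin_E: "finite (carrier E)"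
  unfolding E_eq using t_pos by (rule finite_cyc_prod)

lemma fin_G: "finite (carrier G)"
  using q_pos by (rule finite_cyc_prod)

lemma G_sub_E: "x \<in> carrier G \<Longrightarrow> x \<in> carrier E"
proof -
  have "(\<Pi>\<^sub>E i\<in>{1..m}. {0..<int q}) \<subseteq> (\<Pi>\<^sub>E i\<in>{1..m}. {0..<int (t i)})"
    by (intro PiE_mono ivl_subset[THEN iffD2]) (simp add: q_le_t)
  thus "x \<in> carrier G \<Longrightarrow> x \<in> carrier E" unfolding carrier_G carrier_E by blast
qed

lemma red_in_G: "red x \<in> carrier G"
  unfolding carrier_G red_def using q_pos by auto

lemma red_G: "x \<in> carrier G \<Longrightarrow> red x = x"
  unfolding carrier_G red_def by (auto simp: PiE_iff fun_eq_iff extensional_def)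

lemma red_mult: "red (x \<otimes>\<^bsub>E\<^esub> y) = red x \<otimes>\<^bsub>G\<^esub> red y"
  using q_dvd_t by (auto simp: red_def mult_E mult_cyc_prod fun_eq_iff mod_mod_cancel mod_add_eq)

lemma mod_E: "x \<in> carrier E \<Longrightarrow> (\<lambda>i\<in>{1..m}. x i mod int (t i)) = x"
  unfolding carrier_E by (auto simp: PiE_iff fun_eq_iff extensional_def)

lemma phi_in: "x \<in> carrier G \<Longrightarrow> 0 \<le> \<phi> x \<and> \<phi> x < int h"
  using phi_range h_pos unfolding hary_map_def by (auto simp: carrier_integer_mod_group Pi_iff)

text \<open>Wrapping a coordinate in \<open>J\<close> modulo h q changes its quotient by q by a
  multiple of h; a wrapped coordinate outside \<open>J\<close> is below q and has quotient 0.
  Because u need not be reduced, sums x + y and multiples q g can be inserted directly.\<close>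

lemma expansion_mod:
  "[f (\<lambda>i\<in>{1..m}. u i mod int (t i)) = \<phi> (red u) + (\<Sum>i\<in>J. u i div int q)] (mod int h)"
proof -
  let ?w = "\<lambda>i\<in>{1..m}. u i mod int (t i)"
  have red: "(\<lambda>i\<in>{1..m}. ?w i mod int q) = red u"
    using q_dvd_t by (auto simp: red_def fun_eq_iff mod_mod_cancel)
  have "(\<Sum>i\<in>{1..m}. ?w i div int q) = (\<Sum>i\<in>J. ?w i div int q)"
    using J_sub t_not_J q_pos
    by (intro sum.mono_neutral_right) (auto simp: div_pos_pos_trivial)
  also have "\<dots> = (\<Sum>i\<in>J. u i mod int (t i) div int q)"
    using J_sub by (intro sum.cong) auto
  also have "[\<dots> = (\<Sum>i\<in>J. u i div int q)] (mod int h)"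
  proof (rule cong_sum)
    fix i assume "i \<in> J"
    hence "int (t i) = int q * int h" by (simp add: t_J mult.commute)
    hence "u i mod int (t i) div int q = u i div int q mod int h"
      using q_pos by (simp add: zmod_zmult2_eq)
    thus "[u i mod int (t i) div int q = u i div int q] (mod int h)" by (simp add: cong_def)
  qed
  finally have "[\<phi> (red u) + (\<Sum>i\<in>{1..m}. ?w i div int q) = \<phi> (red u) + (\<Sum>i\<in>J. u i div int q)] (mod int h)"
    by (intro cong_add) auto
  thus ?thesis unfolding expansion_def red by (simp add: cong_def)
qed

lemma expansion_mult:
  "[f (x \<otimes>\<^bsub>E\<^esub> y) = \<phi> (red (\<lambda>i. x i + y i)) + (\<Sum>i\<in>J. (x i + y i) div int q)] (mod int h)"
  unfolding mult_E by (rule expansion_mod)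

lemma expansion_E:
  "x \<in> carrier E \<Longrightarrow> [f x = \<phi> (red x) + (\<Sum>i\<in>J. x i div int q)] (mod int h)"
  using expansion_mod[of x] mod_E[of x] by simp

lemma expansion_range: "f x \<in> {0..<int h}"
  using h_pos by (simp add: expansion_def)

lemma L_iff: "x \<in> L \<longleftrightarrow> x \<in> carrier E \<and> (\<forall>i\<in>{1..m}. int q dvd x i)"
proof
  assume "x \<in> L" thus "x \<in> carrier E \<and> (\<forall>i\<in>{1..m}. int q dvd x i)"
    unfolding L_sub_def by auto
next
  assume x: "x \<in> carrier E \<and> (\<forall>i\<in>{1..m}. int q dvd x i)"
  have "\<exists>y. x i = y * int q \<and> (z i = 1 \<longrightarrow> 0 \<le> y \<and> y < int h) \<and> (z i = 0 \<longrightarrow> y = 0)"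
    if i: "i \<in> {1..m}" for i
  proof -
    obtain y where y: "x i = int q * y" using x i by (elim conjE ballE dvdE) auto
    have r: "0 \<le> x i" "x i < int (t i)" using x i unfolding carrier_E by (auto simp: PiE_iff)
    have y0: "0 \<le> y" using r(1) q_pos by (simp add: y zero_le_mult_iff)
    have "y < int h" if "z i = 1"
    proof -
      have "int q * y < int q * int h" using r(2) t_J[of i] that i by (simp add: y J_def mult.commute)
      thus ?thesis using q_pos by simp
    qed
    moreover have "y = 0" if "z i = 0"
    proof -
      have "int q * y < int q * 1" using r(2) t_not_J[of i] that i by (simp add: y J_def)
      hence "y < 1" using q_pos by (subst (asm) mult_less_cancel_left_pos) auto
      thus ?thesis using y0 by simp
    qed
    ultimately show ?thesis using y y0 by (intro exI[of _ y]) (auto simp: mult.commute)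
  qed
  thus "x \<in> L" using x unfolding L_sub_def by blast
qed

lemma L_iff_red: "x \<in> carrier E \<Longrightarrow> x \<in> L \<longleftrightarrow> red x = \<one>\<^bsub>G\<^esub>"
  by (auto simp: L_iff red_def one_cyc_prod fun_eq_iff restrict_def dvd_eq_mod_eq_0)

lemma red_hom: "group_hom E G red"
  by unfold_locales (auto simp: hom_def red_in_G red_mult)

lemma subgroup_L: "subgroup L E"
proof -
  have "L = kernel E G red" using L_iff_red L_iff by (auto simp: kernel_def)
  thus ?thesis using group_hom.subgroup_kernel[OF red_hom] by simp
qed

lemma expansion_L: "l \<in> L \<Longrightarrow> [f l = (\<Sum>i\<in>J. l i div int q)] (mod int h)"
  using expansion_E[of l] L_iff_red[of l] phi_one by (auto simp: L_iff)

text \<open>Coordinates of l are multiples of q: adding them leaves residues modulo q alone and adds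
  quotients without a carry.\<close>

lemma expansion_mult_L:
  assumes "x \<in> carrier E" "l \<in> L"
  shows "[f (x \<otimes>\<^bsub>E\<^esub> l) = f x + f l] (mod int h)"
proof -
  have d: "int q dvd l i" if "i \<in> {1..m}" for i using assms(2) that by (simp add: L_iff)
  have "red (\<lambda>i. x i + l i) = red x"
    unfolding red_def
  proof (rule restrict_ext)
    fix i assume "i \<in> {1..m}"
    hence "int q dvd l i" by (rule d)
    then obtain y where "l i = int q * y" by (elim dvdE)
    thus "(x i + l i) mod int q = x i mod int q" by simp
  qed
  moreover have "(\<Sum>i\<in>J. (x i + l i) div int q) = (\<Sum>i\<in>J. x i div int q) + (\<Sum>i\<in>J. l i div int q)"
    unfolding sum.distrib[symmetric] using d J_sub by (intro sum.cong refl div_plus_div_distrib_dvd_right) auto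
  ultimately have "[f (x \<otimes>\<^bsub>E\<^esub> l) = (\<phi> (red x) + (\<Sum>i\<in>J. x i div int q)) + (\<Sum>i\<in>J. l i div int q)] (mod int h)"
    using expansion_mult[of x l] by (simp add: add.assoc)
  also have "[(\<phi> (red x) + (\<Sum>i\<in>J. x i div int q)) + (\<Sum>i\<in>J. l i div int q) = f x + f l] (mod int h)"
    using expansion_E[OF assms(1)] expansion_L[OF assms(2)] by (intro cong_add) (auto simp: cong_sym)
  finally show ?thesis .
qed

definition unit_vec where "unit_vec i0 c = (\<lambda>i\<in>{1..m}. if i = i0 then c else 0::int)"

text \<open>This element has three uses: it makes f map \<open>L\<close> onto Z_h, it is the q-th
  multiple of a unit vector that obstructs splitting, and shifting by it kills the spectrum off
  F.\<close>

lemma unit_vec_q: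
  assumes "i0 \<in> J" shows "unit_vec i0 (int q) \<in> L" "f (unit_vec i0 (int q)) = 1"
proof -
  have i0: "i0 \<in> {1..m}" using assms J_sub by auto
  have "int q < int (t i0)" using t_J[OF assms] q_pos h_pos by simp
  thus L: "unit_vec i0 (int q) \<in> L"
    using t_pos by (auto simp: L_iff carrier_E unit_vec_def PiE_iff)
  have "(\<Sum>i\<in>J. unit_vec i0 (int q) i div int q) = (\<Sum>i\<in>J. if i = i0 then 1 else 0)"
    using J_sub q_pos by (intro sum.cong) (auto simp: unit_vec_def)
  also have "\<dots> = 1" using assms by simp
  finally show "f (unit_vec i0 (int q)) = 1"
    using expansion_L[OF L] expansion_range[of "unit_vec i0 (int q)"] h_pos by (auto simp: cong_def)
qed

lemma J_nonempty: "\<exists>i0. i0 \<in> J"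
proof -
  obtain i where i: "i \<in> {1..m}" "z i \<noteq> 0" using z_nonzero by blast
  hence "i \<in> J" using z_cases[OF i(1)] by (simp add: J_def)
  thus ?thesis ..
qed

sublocale Q: hary_quasi_hom E h L f
proof (intro hary_quasi_hom.intro hary_quasi_hom_axioms.intro)
  show "\<exists>l\<in>L. f l = 1" using J_nonempty unit_vec_q by blast
qed (rule E.comm_group_axioms prime_h fin_E subgroup_L expansion_range expansion_mult_L; assumption)+

lemma K_eq: "K_sub h m s z = Q.K"
proof -
  have "f l = 0 \<longleftrightarrow> [(\<Sum>i\<in>{1..m}. l i div int q) = 0] (mod int h)" if "l \<in> L" for l
  proof -
    have "(\<lambda>i\<in>{1..m}. l i mod int q) = \<one>\<^bsub>G\<^esub>"
      using L_iff_red[of l] that by (simp add: L_iff red_def)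
    thus ?thesis using phi_one by (simp add: expansion_def cong_def)
  qed
  thus ?thesis by (auto simp: K_sub_def Q.K_def)
qed

lemma red_decomp:
  assumes x: "x \<in> carrier E" shows "\<exists>l\<in>L. x = red x \<otimes>\<^bsub>E\<^esub> l"
proof
  let ?l = "inv\<^bsub>E\<^esub> (red x) \<otimes>\<^bsub>E\<^esub> x"
  have r: "red x \<in> carrier E" "red x \<in> carrier G" using red_in_G G_sub_E by auto
  show eq: "x = red x \<otimes>\<^bsub>E\<^esub> ?l" using r x by (simp add: E.m_assoc[symmetric])
  have "red x \<otimes>\<^bsub>G\<^esub> red ?l = red x"
    using red_mult[of "red x" ?l] unfolding eq[symmetric] red_G[OF r(2)] by simp
  hence "red ?l = \<one>\<^bsub>G\<^esub>" by (rule G.l_cancel_one[THEN iffD1, OF r(2) red_in_G])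
  thus "?l \<in> L" using r x by (simp add: L_iff_red)
qed

text \<open>\<open>red\<close> recovers the factor in \<open>G\<close>, and cancellation the one in
  \<open>L\<close>.\<close>

lemma GL_decomp: "bij_betw (\<lambda>(c, l). c \<otimes>\<^bsub>E\<^esub> l) (carrier G \<times> L) (carrier E)"
  unfolding bij_betw_def
proof
  have LE: "l \<in> carrier E" if "l \<in> L" for l using that by (simp add: L_iff)
  have red: "red (c \<otimes>\<^bsub>E\<^esub> l) = c" if "c \<in> carrier G" "l \<in> L" for c l
    using that LE L_iff_red[of l] by (simp add: red_mult red_G)
  show "inj_on (\<lambda>(c, l). c \<otimes>\<^bsub>E\<^esub> l) (carrier G \<times> L)"
  proof (rule inj_onI, clarify)
    fix c l c' l'
    assume 1: "c \<in> carrier G" "l \<in> L" "c' \<in> carrier G" "l' \<in> L" "c \<otimes>\<^bsub>E\<^esub> l = c' \<otimes>\<^bsub>E\<^esub> l'"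
    have "c = red (c' \<otimes>\<^bsub>E\<^esub> l')" using red[OF 1(1,2)] unfolding 1(5) ..
    hence "c = c'" using red[OF 1(3,4)] by simp
    thus "c = c' \<and> l = l'" using 1 LE G_sub_E by simp
  qed
  show "(\<lambda>(c, l). c \<otimes>\<^bsub>E\<^esub> l) ` (carrier G \<times> L) = carrier E"
  proof
    show "(\<lambda>(c, l). c \<otimes>\<^bsub>E\<^esub> l) ` (carrier G \<times> L) \<subseteq> carrier E"
      using LE G_sub_E by auto
    show "carrier E \<subseteq> (\<lambda>(c, l). c \<otimes>\<^bsub>E\<^esub> l) ` (carrier G \<times> L)"
    proof
      fix x assume "x \<in> carrier E"
      then obtain l where "l \<in> L" "x = red x \<otimes>\<^bsub>E\<^esub> l" using red_decomp by blast
      thus "x \<in> (\<lambda>(c, l). c \<otimes>\<^bsub>E\<^esub> l) ` (carrier G \<times> L)"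
        using red_in_G[of x] by (intro image_eqI[of _ _ "(red x, l)"]) auto
    qed
  qed
qed

lemma order_G: "order G = q ^ m"
  using order_cyc_prod[of m "\<lambda>_. q"] q_pos by simp

lemma order_E: "order E = q ^ m * card L"
  using bij_betw_same_card[OF GL_decomp] by (simp add: card_cartesian_product order_def order_G[unfolded order_def])

section \<open>The cocycle of an array and its row sums\<close>

definition psi_exponent where
  "psi_exponent x y = (\<Sum>i\<in>J. (x i + y i) div int q) + (\<phi> (x \<otimes>\<^bsub>G\<^esub> y) - \<phi> x - \<phi> y)"

lemma mu_eq: "mu_cocycle h m s z x y = zeta h powi (\<Sum>i\<in>J. (x i + y i) div int q)"
proof -
  have "(\<Prod>i\<in>A. zeta h powi g i) = zeta h powi (\<Sum>i\<in>A. g i)" if "finite A" for A and g :: "nat \<Rightarrow> int"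
    using that by (induction A) (auto simp: power_int_add)
  thus ?thesis unfolding mu_cocycle_def J_def by simp
qed

lemma psi_eq: "\<psi> x y = zeta h powi psi_exponent x y"
  by (simp add: \<psi>_def mu_eq coboundary_def psi_exponent_def power_int_add)

text \<open>In each coordinate both sides are the total carry of three summands, the quotient of a +
  b + c by q.\<close>

lemma carry_cocycle:
  assumes "a \<in> carrier G" "b \<in> carrier G" "c \<in> carrier G"
  shows "(\<Sum>i\<in>J. (a i + b i) div int q) + (\<Sum>i\<in>J. ((a \<otimes>\<^bsub>G\<^esub> b) i + c i) div int q) =
         (\<Sum>i\<in>J. (a i + (b \<otimes>\<^bsub>G\<^esub> c) i) div int q) + (\<Sum>i\<in>J. (b i + c i) div int q)"
proof -
  have *: "x div int q + (x mod int q + y) div int q = (x + y) div int q" for x y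
  proof -
    have "x + y = (x mod int q + y) + (x div int q) * int q"
      using div_mult_mod_eq[of x "int q"] by linarith
    thus ?thesis using q_pos by (simp only: div_mult_self1 of_nat_0_less_iff less_imp_neq)
  qed
  have "(a i + b i) div int q + ((a \<otimes>\<^bsub>G\<^esub> b) i + c i) div int q =
        (a i + (b \<otimes>\<^bsub>G\<^esub> c) i) div int q + (b i + c i) div int q" if "i \<in> J" for i
    using that J_sub *[of "a i + b i" "c i"] *[of "b i + c i" "a i"]
    by (auto simp: mult_cyc_prod algebra_simps subset_iff)
  thus ?thesis unfolding sum.distrib[symmetric] by (intro sum.cong) auto
qed

lemma G_nonneg: "x \<in> carrier G \<Longrightarrow> i \<in> {1..m} \<Longrightarrow> 0 \<le> x i \<and> x i < int q"
  unfolding carrier_G by (auto simp: PiE_iff)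

lemma mu_cocycle: "mu_cocycle h m s z \<in> cocycles G h"
proof -
  have "(\<lambda>x y. zeta h powi (\<Sum>i\<in>J. (x i + y i) div int q)) \<in> cocycles G h"
    using h_pos carry_cocycle J_sub
    by (intro cocycles_zeta_powiI) (auto simp: one_cyc_prod subset_iff intro!: sum.neutral)
  thus ?thesis unfolding mu_eq[abs_def] .
qed

lemma psi_cocycle: "\<psi> \<in> cocycles G h"
proof -
  have one: "psi_exponent \<one>\<^bsub>G\<^esub> \<one>\<^bsub>G\<^esub> = 0"
  proof -
    have "(\<Sum>i\<in>J. (\<one>\<^bsub>G\<^esub> i + \<one>\<^bsub>G\<^esub> i) div int q) = 0"
      using J_sub by (auto simp: one_cyc_prod subset_iff intro!: sum.neutral)
    moreover have "\<one>\<^bsub>G\<^esub> \<otimes>\<^bsub>G\<^esub> \<one>\<^bsub>G\<^esub> = \<one>\<^bsub>G\<^esub>" by (rule G.r_one[OF G.one_closed])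
    ultimately show ?thesis unfolding psi_exponent_def by (simp only: phi_one)
  qed
  have "(\<lambda>x y. zeta h powi psi_exponent x y) \<in> cocycles G h"
  proof (rule cocycles_zeta_powiI)
    fix a b c assume abc: "a \<in> carrier G" "b \<in> carrier G" "c \<in> carrier G"
    thus "psi_exponent a b + psi_exponent (a \<otimes>\<^bsub>G\<^esub> b) c = psi_exponent a (b \<otimes>\<^bsub>G\<^esub> c) + psi_exponent b c"
      using carry_cocycle[OF abc] unfolding psi_exponent_def by (simp add: G.m_assoc)
  qed (use one h_pos in auto)
  thus ?thesis unfolding psi_eq[abs_def] .
qed

text \<open>On the section \<open>G\<close> the expansion equals \<open>\<phi>\<close>, so this
  exhibits the exponent of \<open>\<psi>\<close> as the defect of additivity of the
  expansion.\<close>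

lemma expansion_mult_G:
  assumes "a \<in> carrier G" "c \<in> carrier G"
  shows "[f (c \<otimes>\<^bsub>E\<^esub> a) = psi_exponent a c + \<phi> a + \<phi> c] (mod int h)"
proof -
  have "red (\<lambda>i. c i + a i) = a \<otimes>\<^bsub>G\<^esub> c"
    by (auto simp: red_def mult_cyc_prod add.commute)
  thus ?thesis using expansion_mult[of c a] by (simp add: psi_exponent_def add.commute)
qed

lemma expansion_G: "c \<in> carrier G \<Longrightarrow> f c = \<phi> c"
proof -
  assume c: "c \<in> carrier G"
  have "(\<Sum>i\<in>{1..m}. c i div int q) = 0"
    using G_nonneg[OF c] by (intro sum.neutral) (auto simp: div_pos_pos_trivial)
  thus ?thesis using phi_in[OF c] red_G[OF c] by (simp add: expansion_def red_def)
qed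

text \<open>Writing each point of \<open>E\<close> as c l, the contribution of l cancels in the
  difference of the two values. Each c is thus counted |L| times, with the conjugate of
  \<open>\<psi> a c\<close> left over.\<close>

lemma AC_G:
  assumes a: "a \<in> carrier G"
  shows "AC h E f a = of_nat (card L) * zeta h powi (- \<phi> a) * cnj (\<Sum>c\<in>carrier G. \<psi> a c)"
proof -
  have LE: "l \<in> carrier E" if "l \<in> L" for l using that by (simp add: L_iff)
  have "AC h E f a = (\<Sum>p\<in>carrier G \<times> L. case p of (c, l) \<Rightarrow>
      zeta h powi (f (c \<otimes>\<^bsub>E\<^esub> l) - f (c \<otimes>\<^bsub>E\<^esub> l \<otimes>\<^bsub>E\<^esub> a)))"
    unfolding AC_def by (subst sum.reindex_bij_betw[OF GL_decomp, symmetric]) (simp add: case_prod_unfold)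
  also have "\<dots> = (\<Sum>c\<in>carrier G. \<Sum>l\<in>L. zeta h powi (f (c \<otimes>\<^bsub>E\<^esub> l) - f (c \<otimes>\<^bsub>E\<^esub> l \<otimes>\<^bsub>E\<^esub> a)))"
    by (rule sum.cartesian_product[symmetric])
  also have "\<dots> = (\<Sum>c\<in>carrier G. \<Sum>l\<in>L. zeta h powi (- \<phi> a) * cnj (\<psi> a c))"
  proof (intro sum.cong refl)
    fix c l assume c: "c \<in> carrier G" and l: "l \<in> L"
    have E: "a \<in> carrier E" "c \<in> carrier E" "l \<in> carrier E" using a c l LE G_sub_E by auto
    have eq: "c \<otimes>\<^bsub>E\<^esub> l \<otimes>\<^bsub>E\<^esub> a = (c \<otimes>\<^bsub>E\<^esub> a) \<otimes>\<^bsub>E\<^esub> l" using E by (simp add: E.m_ac)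
    have "[f (c \<otimes>\<^bsub>E\<^esub> l) - f (c \<otimes>\<^bsub>E\<^esub> l \<otimes>\<^bsub>E\<^esub> a) = (f c + f l) - (f (c \<otimes>\<^bsub>E\<^esub> a) + f l)] (mod int h)"
      unfolding eq using E l by (intro cong_diff expansion_mult_L) auto
    also have "(f c + f l) - (f (c \<otimes>\<^bsub>E\<^esub> a) + f l) = \<phi> c - f (c \<otimes>\<^bsub>E\<^esub> a)"
      using expansion_G[OF c] by simp
    also have "[\<phi> c - f (c \<otimes>\<^bsub>E\<^esub> a) = \<phi> c - (psi_exponent a c + \<phi> a + \<phi> c)] (mod int h)"
      using expansion_mult_G[OF a c] by (intro cong_diff) auto
    also have "\<phi> c - (psi_exponent a c + \<phi> a + \<phi> c) = - \<phi> a + - psi_exponent a c" by simp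
    finally have "zeta h powi (f (c \<otimes>\<^bsub>E\<^esub> l) - f (c \<otimes>\<^bsub>E\<^esub> l \<otimes>\<^bsub>E\<^esub> a)) = zeta h powi (- \<phi> a + - psi_exponent a c)"
      using h_pos by (intro zeta_powi_cong)
    thus "zeta h powi (f (c \<otimes>\<^bsub>E\<^esub> l) - f (c \<otimes>\<^bsub>E\<^esub> l \<otimes>\<^bsub>E\<^esub> a)) = zeta h powi (- \<phi> a) * cnj (\<psi> a c)"
      unfolding psi_eq cnj_zeta_powi by (subst (asm) power_int_add) auto
  qed
  finally show ?thesis by (simp add: sum_distrib_left mult_ac)
qed

lemma orthogonal_iff_AC:
  "(\<forall>a\<in>carrier G - {\<one>\<^bsub>G\<^esub>}. (\<Sum>c\<in>carrier G. \<psi> a c) = 0) \<longleftrightarrow>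
   (\<forall>g\<in>carrier E - L. AC h E f g = 0)"
proof -
  have cL: "card L > 0"
    using Q.finL subgroup.one_closed[OF subgroup_L] by (auto simp: card_gt_0_iff)
  have AC0: "AC h E f a = 0 \<longleftrightarrow> (\<Sum>c\<in>carrier G. \<psi> a c) = 0" if "a \<in> carrier G" for a
    unfolding AC_G[OF that] using cL by (simp del: cnj_sum)
  show ?thesis
  proof
    assume l: "\<forall>a\<in>carrier G - {\<one>\<^bsub>G\<^esub>}. (\<Sum>c\<in>carrier G. \<psi> a c) = 0"
    show "\<forall>g\<in>carrier E - L. AC h E f g = 0"
    proof
      fix g assume g: "g \<in> carrier E - L"
      hence "g \<in> (\<lambda>(c, l). c \<otimes>\<^bsub>E\<^esub> l) ` (carrier G \<times> L)"
        using GL_decomp by (simp add: bij_betw_def)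
      then obtain a l where al: "a \<in> carrier G" "l \<in> L" "g = a \<otimes>\<^bsub>E\<^esub> l" by auto
      have "a \<noteq> \<one>\<^bsub>G\<^esub>"
      proof
        assume "a = \<one>\<^bsub>G\<^esub>"
        hence "a \<in> L" using L_iff_red[of a] G_sub_E al(1) red_G by simp
        hence "g \<in> L" using al subgroup_L by (simp add: subgroup.m_closed)
        thus False using g by simp
      qed
      hence "AC h E f a = 0" using l al AC0 by simp
      thus "AC h E f g = 0" using Q.AC_mult_L[of a l] al G_sub_E by simp
    qed
  next
    assume r: "\<forall>g\<in>carrier E - L. AC h E f g = 0"
    show "\<forall>a\<in>carrier G - {\<one>\<^bsub>G\<^esub>}. (\<Sum>c\<in>carrier G. \<psi> a c) = 0"
    proof
      fix a assume a: "a \<in> carrier G - {\<one>\<^bsub>G\<^esub>}"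
      hence "a \<in> carrier E - L" using L_iff_red[of a] G_sub_E red_G by auto
      thus "(\<Sum>c\<in>carrier G. \<psi> a c) = 0" using r a AC0 by blast
    qed
  qed
qed

lemma GPhA_iff: "is_GPhA h m s z \<phi> \<longleftrightarrow> (\<forall>g\<in>carrier E - L. AC h E f g = 0)"
  using phi_range by (simp add: is_GPhA_def)

lemma cond_i_iff:
  "symmetric_cocycle G h \<psi> \<and> orthogonal_cocycle G h \<psi> \<longleftrightarrow> is_GPhA h m s z \<phi>"
proof -
  have "symmetric_cocycle G h \<psi>"
  proof (rule G.symmetric_cocycleI[OF fin_G psi_cocycle])
    fix a b assume "a \<in> carrier G" "b \<in> carrier G"
    thus "\<psi> a b = \<psi> b a" by (simp add: psi_eq psi_exponent_def add.commute G.m_comm algebra_simps)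
  qed
  thus ?thesis unfolding orthogonal_cocycle_def GPhA_iff orthogonal_iff_AC[symmetric]
    using psi_cocycle G.cocycle_mat_BH_iff[OF fin_G psi_cocycle] by simp
qed

lemma m_pos: "m \<ge> 1"
  using z_nonzero by auto

lemma pow_unit_vec: "unit_vec i0 1 [^]\<^bsub>E\<^esub> q = unit_vec i0 (int q)" if "i0 \<in> J"
proof -
  have q: "q < h * q" using q_pos h_pos by simp
  have "unit_vec i0 1 \<in> carrier E" unfolding carrier_E
    using q_gt q_le_t t_pos by (auto simp: unit_vec_def PiE_iff intro: less_le_trans)
  thus ?thesis unfolding E_eq
    using pow_cyc_prod[of "unit_vec i0 1" m t q] t_J[OF that] q by (auto simp: unit_vec_def fun_eq_iff)
qed

lemma nonsplit: "\<not> direct_factor (E Mod Q.K) ((\<lambda>g. Q.K #>\<^bsub>E\<^esub> g) ` L)"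
proof -
  obtain i0 where i0: "i0 \<in> J" using J_nonempty by blast
  have "unit_vec i0 1 \<in> carrier E" unfolding carrier_E
    using q_gt q_le_t t_pos by (auto simp: unit_vec_def PiE_iff intro: less_le_trans)
  thus ?thesis
    using i0 unit_vec_q[OF i0] pow_unit_vec[OF i0] h_dvd_q
    by (intro Q.not_direct_factor_L_Mod_K[of "unit_vec i0 1" q]) auto
qed

lemma cond_iii_iff:
  "is_nonsplitting_RDS (E Mod K_sub h m s z) ((\<lambda>g. K_sub h m s z #>\<^bsub>E\<^esub> g) ` L)
      (q ^ m) h (q ^ m) (q ^ m div h) {K_sub h m s z #>\<^bsub>E\<^esub> g |g. g \<in> carrier E \<and> f g = 0}
   \<longleftrightarrow> is_GPhA h m s z \<phi>"
proof -
  have "h dvd q ^ m" using dvd_trans[OF h_dvd_q dvd_power[of m q]] m_pos by simp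
  thus ?thesis unfolding is_nonsplitting_RDS_def K_eq GPhA_iff
    using nonsplit Q.is_RDS_iff[OF order_E] by (simp add: Q.R_def)
qed

end

subsection \<open>Spectra\<close>

text \<open>The Wiener-Khinchin identity: expand the square into a double sum over x and y and
  substitute y = x w; the unimodular factor at x cancels.\<close>

lemma (in comm_group) norm_twisted_sum:
  assumes chi: "\<And>x y. x \<in> carrier G \<Longrightarrow> y \<in> carrier G \<Longrightarrow> \<kappa> (x \<otimes> y) = \<kappa> x * \<kappa> y"
    and unit: "\<And>x. x \<in> carrier G \<Longrightarrow> \<kappa> x * cnj (\<kappa> x) = 1"
  shows "of_real ((cmod (\<Sum>x\<in>carrier G. zeta h powi f x * \<kappa> x))\<^sup>2) =
         (\<Sum>w\<in>carrier G. AC h G f w * cnj (\<kappa> w))"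
proof -
  let ?u = "\<lambda>x. zeta h powi f x * \<kappa> x"
  have "of_real ((cmod (\<Sum>x\<in>carrier G. ?u x))\<^sup>2) = (\<Sum>x\<in>carrier G. ?u x) * cnj (\<Sum>x\<in>carrier G. ?u x)"
    by (rule complex_norm_square)
  also have "\<dots> = (\<Sum>x\<in>carrier G. \<Sum>y\<in>carrier G. ?u x * cnj (?u y))"
    by (simp only: cnj_sum sum_product)
  also have "\<dots> = (\<Sum>x\<in>carrier G. \<Sum>w\<in>carrier G. zeta h powi (f x - f (x \<otimes> w)) * cnj (\<kappa> w))"
  proof (rule sum.cong[OF refl])
    fix x assume x: "x \<in> carrier G"
    have "bij_betw (\<lambda>w. x \<otimes> w) (carrier G) (carrier G)"
      using x by (intro bij_betw_byWitness[where f' = "\<lambda>w. inv x \<otimes> w"]) (auto simp: m_assoc[symmetric])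
    hence "(\<Sum>y\<in>carrier G. ?u x * cnj (?u y)) = (\<Sum>w\<in>carrier G. ?u x * cnj (?u (x \<otimes> w)))"
      by (rule sum.reindex_bij_betw[symmetric])
    also have "\<dots> = (\<Sum>w\<in>carrier G. zeta h powi (f x - f (x \<otimes> w)) * cnj (\<kappa> w))"
    proof (rule sum.cong[OF refl])
      fix w assume w: "w \<in> carrier G"
      have "?u x * cnj (?u (x \<otimes> w)) =
          (zeta h powi f x * zeta h powi (- f (x \<otimes> w))) * (\<kappa> x * cnj (\<kappa> x)) * cnj (\<kappa> w)"
        unfolding chi[OF x w] complex_cnj_mult cnj_zeta_powi by (simp only: mult_ac)
      also have "zeta h powi f x * zeta h powi (- f (x \<otimes> w)) = zeta h powi (f x + - f (x \<otimes> w))"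
        by (rule power_int_add[symmetric]) simp
      finally show "?u x * cnj (?u (x \<otimes> w)) = zeta h powi (f x - f (x \<otimes> w)) * cnj (\<kappa> w)"
        unfolding unit[OF x] by simp
    qed
    finally show "(\<Sum>y\<in>carrier G. ?u x * cnj (?u y)) =
        (\<Sum>w\<in>carrier G. zeta h powi (f x - f (x \<otimes> w)) * cnj (\<kappa> w))" .
  qed
  also have "\<dots> = (\<Sum>w\<in>carrier G. AC h G f w * cnj (\<kappa> w))"
    by (subst sum.swap) (simp only: AC_def sum_distrib_right)
  finally show ?thesis .
qed

locale hary_array_all_one = hary_array +
  assumes all_one: "\<And>i. i \<in> {1..m} \<Longrightarrow> z i = 1"
begin

definition T where "T = h * q"
text \<open>The characters of \<open>E\<close>, conjugated as in the spectrum. The formula is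
  symmetric in both arguments, which provides the dual orthogonality relations as well.\<close>

definition \<kappa> where "\<kappa> v x = zeta T powi (- (\<Sum>i\<in>{1..m}. v i * x i))"
definition F where "F = {v \<in> carrier E. \<forall>i\<in>{1..m}. [v i = 1] (mod int h)}"

lemma J_eq: "J = {1..m}"
  using all_one by (auto simp: J_def)

lemma t_eq: "i \<in> {1..m} \<Longrightarrow> t i = T"
  using t_J J_eq by (simp add: T_def)

lemma T_pos: "T > 0"
  using h_pos q_pos by (simp add: T_def)

lemma E_full: "E = cyc_pow T m"
  unfolding E_eq using t_eq by (rule cyc_prod_cong)

lemma mult_full: "x \<otimes>\<^bsub>E\<^esub> y = (\<lambda>i\<in>{1..m}. (x i + y i) mod int T)"
  unfolding E_full by (rule mult_cyc_prod)

lemma carrier_full: "carrier E = (\<Pi>\<^sub>E i\<in>{1..m}. {0..<int T})"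
  unfolding E_full using T_pos by (intro carrier_cyc_prod)

lemma order_full: "order E = T ^ m"
proof -
  have "order E = (\<Prod>i\<in>{1..m}. T)" unfolding E_full using T_pos by (intro order_cyc_prod)
  thus ?thesis by simp
qed

lemma card_L: "card L = h ^ m"
  using order_full order_E q_pos by (simp add: T_def power_mult_distrib mult.commute)

lemma chi_sym: "\<kappa> v x = \<kappa> x v"
  by (simp add: \<kappa>_def mult.commute)

lemma chi_mult: "\<kappa> v (x \<otimes>\<^bsub>E\<^esub> y) = \<kappa> v x * \<kappa> v y"
proof -
  have "[(\<Sum>i\<in>{1..m}. v i * (x \<otimes>\<^bsub>E\<^esub> y) i) = (\<Sum>i\<in>{1..m}. v i * (x i + y i))] (mod int T)"
    by (intro cong_sum cong_mult cong_refl) (simp add: mult_full cong_def)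
  hence "[- (\<Sum>i\<in>{1..m}. v i * (x \<otimes>\<^bsub>E\<^esub> y) i) = - (\<Sum>i\<in>{1..m}. v i * (x i + y i))] (mod int T)"
    by (simp add: cong_minus_minus_iff)
  hence "\<kappa> v (x \<otimes>\<^bsub>E\<^esub> y) = zeta T powi (- (\<Sum>i\<in>{1..m}. v i * (x i + y i)))"
    unfolding \<kappa>_def using T_pos by (rule zeta_powi_cong)
  also have "- (\<Sum>i\<in>{1..m}. v i * (x i + y i)) = - (\<Sum>i\<in>{1..m}. v i * x i) + - (\<Sum>i\<in>{1..m}. v i * y i)"
    by (simp add: distrib_left sum.distrib)
  also have "zeta T powi \<dots> = \<kappa> v x * \<kappa> v y" unfolding \<kappa>_def by (rule power_int_add) simp
  finally show ?thesis .
qed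

lemma chi_mult_left: "\<kappa> (u \<otimes>\<^bsub>E\<^esub> v) x = \<kappa> u x * \<kappa> v x"
  using chi_mult[of x u v] by (simp only: chi_sym[of _ x])

lemma chi_cnj: "\<kappa> v x * cnj (\<kappa> v x) = 1"
  unfolding \<kappa>_def complex_norm_square[symmetric] norm_zeta_powi by simp

lemma chi_unit_vec:
  assumes "i0 \<in> {1..m}" shows "\<kappa> v (unit_vec i0 c) = zeta T powi (- (v i0 * c))"
proof -
  have "(\<Sum>i\<in>{1..m}. v i * unit_vec i0 c i) = (\<Sum>i\<in>{1..m}. if i = i0 then v i0 * c else 0)"
    by (intro sum.cong) (auto simp: unit_vec_def)
  also have "\<dots> = v i0 * c" using assms by simp
  finally show ?thesis by (simp add: \<kappa>_def)
qed

lemma spectrum_eq: "spectrum_sum h T m f v = (\<Sum>x\<in>carrier E. zeta h powi f x * \<kappa> v x)"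
  by (simp add: spectrum_sum_def \<kappa>_def E_full)

lemma spectrum_norm:
  "of_real ((cmod (spectrum_sum h T m f v))\<^sup>2) = (\<Sum>w\<in>carrier E. AC h E f w * cnj (\<kappa> v w))"
  unfolding spectrum_eq by (rule E.norm_twisted_sum) (rule chi_mult chi_cnj)+

lemma bij_mult: "l \<in> carrier E \<Longrightarrow> bij_betw (\<lambda>x. x \<otimes>\<^bsub>E\<^esub> l) (carrier E) (carrier E)"
  by (rule bij_betw_byWitness[where f' = "\<lambda>w. w \<otimes>\<^bsub>E\<^esub> inv\<^bsub>E\<^esub> l"]) (auto simp: E.m_assoc)

text \<open>If coordinate i0 of v is not 1 modulo h, shifting x by q in that coordinate multiplies
  every summand by the power of \<open>zeta h\<close> with exponent 1 - v i0, which is not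
  1.\<close>

lemma spectrum_off_F:
  assumes v: "v \<in> carrier E" "v \<notin> F" shows "spectrum_sum h T m f v = 0"
proof -
  obtain i0 where i0: "i0 \<in> {1..m}" "\<not> [v i0 = 1] (mod int h)" using v by (auto simp: F_def)
  let ?l = "unit_vec i0 (int q)"
  have l: "?l \<in> L" "f ?l = 1" using unit_vec_q[of i0] i0(1) J_eq by auto
  have lE: "?l \<in> carrier E" using l(1) by (simp add: L_iff)
  have chil: "\<kappa> v ?l = zeta h powi (- v i0)"
  proof -
    have "\<kappa> v ?l = zeta (h * q) powi (int q * (- v i0))"
      unfolding chi_unit_vec[OF i0(1)] T_def by (simp add: mult.commute)
    thus ?thesis by (simp only: zeta_mult_powi[OF q_pos])
  qed
  show ?thesis
    unfolding spectrum_eq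
  proof (rule sum_eq_0_by_shift[OF bij_mult[OF lE]])
    fix x assume x: "x \<in> carrier E"
    have "zeta h powi f (x \<otimes>\<^bsub>E\<^esub> ?l) = zeta h powi (f x + f ?l)"
      using expansion_mult_L[OF x l(1)] h_pos(1) by (rule zeta_powi_cong)
    also have "\<dots> = zeta h powi f x * zeta h powi 1" unfolding l(2) by (rule power_int_add) simp
    finally show "zeta h powi f (x \<otimes>\<^bsub>E\<^esub> ?l) * \<kappa> v (x \<otimes>\<^bsub>E\<^esub> ?l) =
        (zeta h powi 1 * zeta h powi (- v i0)) * (zeta h powi f x * \<kappa> v x)"
      unfolding chi_mult chil by (simp only: mult_ac)
  next
    have "\<not> int h dvd 1 - v i0" using i0(2) by (simp add: cong_iff_dvd_diff dvd_diff_commute)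
    hence "zeta h powi (1 + - v i0) \<noteq> 1" using zeta_powi_eq_1_iff[OF h_pos(1), of "1 + - v i0"] by simp
    thus "zeta h powi 1 * zeta h powi (- v i0) \<noteq> 1" by (subst (asm) power_int_add) auto
  qed
qed

text \<open>For l = q y the product of v and l is q times that of v and y, so the root of unity has
  order dividing h and v may be replaced by the all-ones vector. What remains is the sum of y, the
  value of the expansion on \<open>L\<close>.\<close>

lemma chi_L:
  assumes v: "v \<in> F" and l: "l \<in> L"
  shows "cnj (\<kappa> v l) = zeta h powi f l"
proof -
  have d: "l i = int q * (l i div int q)" if "i \<in> {1..m}" for i using l that by (simp add: L_iff)
  have eq: "(\<Sum>i\<in>{1..m}. v i * l i) = int q * (\<Sum>i\<in>{1..m}. v i * (l i div int q))"
    unfolding sum_distrib_left by (intro sum.cong refl) (metis d mult.left_commute)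
  have "cnj (\<kappa> v l) = zeta (h * q) powi (int q * (\<Sum>i\<in>{1..m}. v i * (l i div int q)))"
    unfolding \<kappa>_def cnj_zeta_powi T_def eq by (simp only: minus_minus)
  also have "\<dots> = zeta h powi (\<Sum>i\<in>{1..m}. v i * (l i div int q))" by (rule zeta_mult_powi[OF q_pos])
  also have "\<dots> = zeta h powi f l"
  proof (rule zeta_powi_cong[OF _ h_pos(1)])
    have "[(\<Sum>i\<in>{1..m}. v i * (l i div int q)) = (\<Sum>i\<in>{1..m}. 1 * (l i div int q))] (mod int h)"
      using v by (intro cong_sum cong_mult cong_refl) (auto simp: F_def)
    also have "[(\<Sum>i\<in>{1..m}. 1 * (l i div int q)) = f l] (mod int h)"
      using expansion_L[OF l] J_eq by (simp add: cong_sym)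
    finally show "[(\<Sum>i\<in>{1..m}. v i * (l i div int q)) = f l] (mod int h)" .
  qed
  finally show ?thesis .
qed

text \<open>Origin of the constant: on \<open>F\<close> the squared modulus reduces to a sum over
  \<open>L\<close> whose terms all equal |E|, and (h q)^m h^m is this product.\<close>

lemma spectrum_value_eq: "order E * card L = (h\<^sup>2 * q) ^ m"
  unfolding order_full card_L T_def by (simp add: power_mult_distrib power2_eq_square)

lemma spectrum_on_F:
  assumes AC: "\<forall>g\<in>carrier E - L. AC h E f g = 0" and v: "v \<in> F"
  shows "(cmod (spectrum_sum h T m f v))\<^sup>2 = real ((h\<^sup>2 * q) ^ m)"
proof -
  have LE: "L \<subseteq> carrier E" by (auto simp: L_iff)
  have "of_real ((cmod (spectrum_sum h T m f v))\<^sup>2) = (\<Sum>w\<in>L. AC h E f w * cnj (\<kappa> v w))"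
    unfolding spectrum_norm using AC by (intro sum.mono_neutral_right[OF fin_E LE]) auto
  also have "\<dots> = (\<Sum>w\<in>L. of_nat (order E))"
  proof (rule sum.cong[OF refl])
    fix l assume l: "l \<in> L"
    have "AC h E f l * cnj (\<kappa> v l) = of_nat (order E) * (zeta h powi (- f l) * zeta h powi f l)"
      unfolding Q.AC_on_L[OF l] chi_L[OF v l] by (simp only: mult.assoc)
    also have "zeta h powi (- f l) * zeta h powi f l = zeta h powi (- f l + f l)"
      by (rule power_int_add[symmetric]) simp
    finally show "AC h E f l * cnj (\<kappa> v l) = of_nat (order E)" by simp
  qed
  also have "\<dots> = of_nat (order E * card L)" by simp
  also have "\<dots> = complex_of_real (real ((h\<^sup>2 * q) ^ m))" unfolding spectrum_value_eq by simp
  finally show ?thesis by (simp only: of_real_eq_iff)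
qed

text \<open>Shifting v by the unit vector of a coordinate where w and g differ contributes a T-th
  root of unity whose exponent is the difference of two distinct residues.\<close>

lemma chi_orthogonal:
  assumes wg: "w \<in> carrier E" "g \<in> carrier E" "w \<noteq> g"
  shows "(\<Sum>v\<in>carrier E. cnj (\<kappa> v w) * \<kappa> v g) = 0"
proof -
  obtain i0 where i0: "i0 \<in> {1..m}" "w i0 \<noteq> g i0"
    using wg unfolding carrier_full by (meson PiE_ext)
  let ?e = "unit_vec i0 1"
  have T1: "T > 1" unfolding T_def by (rule less_1_mult) (fact h_pos(2) q_gt)+
  have e: "?e \<in> carrier E" using T1 by (auto simp: carrier_full unit_vec_def)
  show ?thesis
  proof (rule sum_eq_0_by_shift[OF bij_mult[OF e]])
    fix v
    show "cnj (\<kappa> (v \<otimes>\<^bsub>E\<^esub> ?e) w) * \<kappa> (v \<otimes>\<^bsub>E\<^esub> ?e) g = 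
        (cnj (\<kappa> ?e w) * \<kappa> ?e g) * (cnj (\<kappa> v w) * \<kappa> v g)"
      unfolding chi_mult_left complex_cnj_mult by (simp only: mult_ac)
    have "cnj (\<kappa> ?e w) * \<kappa> ?e g = zeta T powi (w i0) * zeta T powi (- g i0)"
      unfolding chi_sym[of ?e] chi_unit_vec[OF i0(1)] cnj_zeta_powi by simp
    also have "\<dots> = zeta T powi (w i0 + - g i0)" by (rule power_int_add[symmetric]) simp
    finally have eq: "cnj (\<kappa> ?e w) * \<kappa> ?e g = zeta T powi (w i0 - g i0)" by simp
    have "0 \<le> w i0" "w i0 < int T" "0 \<le> g i0" "g i0 < int T"
      using wg(1,2) i0(1) unfolding carrier_full by (auto simp: PiE_iff)
    hence "\<not> int T dvd w i0 - g i0" using i0(2) by (simp add: mod_eq_dvd_iff[symmetric])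
    thus "cnj (\<kappa> ?e w) * \<kappa> ?e g \<noteq> 1" unfolding eq by (simp add: zeta_powi_eq_1_iff[OF T_pos])
  qed
qed

text \<open>\<open>F\<close> is a coset of the multiples of h, so adding h in one coordinate
  permutes it. In a coordinate of g not divisible by q this multiplies the sum by a q-th root of
  unity other than 1.\<close>

lemma chi_sum_F:
  assumes g: "g \<in> carrier E - L" shows "(\<Sum>v\<in>F. \<kappa> v g) = 0"
proof -
  obtain i0 where i0: "i0 \<in> {1..m}" "\<not> int q dvd g i0" using g by (auto simp: L_iff)
  let ?e = "unit_vec i0 (int h)"
  have hT: "h < T" using h_pos q_gt by (simp add: T_def)
  have e: "?e \<in> carrier E" using hT by (auto simp: carrier_full unit_vec_def)
  have FE: "F \<subseteq> carrier E" by (auto simp: F_def)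
  have finF: "finite F" using FE fin_E by (rule finite_subset)
  have inj: "inj_on (\<lambda>x. x \<otimes>\<^bsub>E\<^esub> ?e) F"
    using bij_mult[OF e] FE unfolding bij_betw_def by (blast intro: inj_on_subset)
  have closed: "(\<lambda>x. x \<otimes>\<^bsub>E\<^esub> ?e) ` F \<subseteq> F"
  proof (rule image_subsetI)
    fix v assume v: "v \<in> F"
    have "[(v \<otimes>\<^bsub>E\<^esub> ?e) i = 1] (mod int h)" if i: "i \<in> {1..m}" for i
    proof -
      have "(v \<otimes>\<^bsub>E\<^esub> ?e) i mod int h = (v i + ?e i) mod int T mod int h"
        using i by (simp add: mult_full)
      also have "\<dots> = (v i + ?e i) mod int h" by (simp add: T_def mod_mod_cancel)
      also have "\<dots> = v i mod int h" using i by (simp add: unit_vec_def)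
      finally show ?thesis using v i by (simp add: F_def cong_def)
    qed
    thus "v \<otimes>\<^bsub>E\<^esub> ?e \<in> F" using v e FE by (auto simp: F_def)
  qed
  have bij: "bij_betw (\<lambda>x. x \<otimes>\<^bsub>E\<^esub> ?e) F F"
    unfolding bij_betw_def using inj endo_inj_surj[OF finF closed inj] by blast
  show ?thesis
  proof (rule sum_eq_0_by_shift[OF bij])
    fix v show "\<kappa> (v \<otimes>\<^bsub>E\<^esub> ?e) g = \<kappa> ?e g * \<kappa> v g" unfolding chi_mult_left by (rule mult.commute)
    have "\<kappa> ?e g = zeta (q * h) powi (int h * (- g i0))"
      unfolding chi_sym[of ?e] chi_unit_vec[OF i0(1)] T_def by (simp add: mult.commute)
    also have "\<dots> = zeta q powi (- g i0)" by (rule zeta_mult_powi[OF h_pos(1)])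
    finally show "\<kappa> ?e g \<noteq> 1" using i0(2) zeta_powi_eq_1_iff[OF q_pos, of "- g i0"] by simp
  qed
qed

text \<open>Fourier inversion: summing the squared moduli against the character at g gives |E| times
  \<open>AC\<close> at g, while for a spectrum constant on \<open>F\<close> it gives a multiple of
  the character sum over \<open>F\<close>.\<close>

lemma AC_eq_0_if_spectrum:
  assumes S: "\<And>v. v \<in> carrier E \<Longrightarrow> (cmod (spectrum_sum h T m f v))\<^sup>2 = (if v \<in> F then c else 0)"
    and g: "g \<in> carrier E - L"
  shows "AC h E f g = 0"
proof -
  have gE: "g \<in> carrier E" using g by simp
  have "(\<Sum>v\<in>carrier E. of_real ((cmod (spectrum_sum h T m f v))\<^sup>2) * \<kappa> v g) =
      (\<Sum>v\<in>carrier E. if v \<in> F then of_real c * \<kappa> v g else 0)"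
    by (intro sum.cong refl) (simp add: S)
  also have "\<dots> = (\<Sum>v\<in>F. of_real c * \<kappa> v g)"
    using fin_E by (simp add: sum.If_cases) (auto simp: F_def intro: sum.cong)
  also have "\<dots> = 0" unfolding sum_distrib_left[symmetric] chi_sum_F[OF g] by simp
  finally have "0 = (\<Sum>v\<in>carrier E. (\<Sum>w\<in>carrier E. AC h E f w * cnj (\<kappa> v w)) * \<kappa> v g)"
    by (simp only: spectrum_norm)
  also have "\<dots> = (\<Sum>w\<in>carrier E. AC h E f w * (\<Sum>v\<in>carrier E. cnj (\<kappa> v w) * \<kappa> v g))"
    unfolding sum_distrib_left sum_distrib_right by (subst sum.swap) (simp only: mult.assoc)
  also have "\<dots> = (\<Sum>w\<in>carrier E. if w = g then AC h E f g * of_nat (order E) else 0)"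
  proof (rule sum.cong[OF refl])
    fix w assume w: "w \<in> carrier E"
    have "(\<Sum>v\<in>carrier E. cnj (\<kappa> v g) * \<kappa> v g) = of_nat (order E)"
      using chi_cnj[of _ g] by (simp add: order_def mult.commute)
    thus "AC h E f w * (\<Sum>v\<in>carrier E. cnj (\<kappa> v w) * \<kappa> v g) =
        (if w = g then AC h E f g * of_nat (order E) else 0)"
      using chi_orthogonal[OF w gE] by (cases "w = g") auto
  qed
  also have "\<dots> = AC h E f g * of_nat (order E)" using gE fin_E by simp
  finally show ?thesis using T_pos by (simp add: order_full)
qed

lemma hary_map_expansion: "hary_map h E f"
  unfolding hary_map_def using expansion_range h_pos by (simp add: carrier_integer_mod_group)

lemma cond_iv_iff:
  "gen_plateaued h T m f \<and> (\<forall>v \<in> carrier (cyc_pow T m).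
      (cmod (spectrum_sum h T m f v))\<^sup>2 = (if v \<in> F then real ((h\<^sup>2 * q) ^ m) else 0)) \<longleftrightarrow>
   (\<forall>g\<in>carrier E - L. AC h E f g = 0)" (is "?P \<and> ?S \<longleftrightarrow> ?A")
proof
  assume "?P \<and> ?S"
  thus ?A using AC_eq_0_if_spectrum unfolding E_full[symmetric] by blast
next
  assume A: ?A
  have S: ?S
    unfolding E_full[symmetric]
  proof
    fix v assume v: "v \<in> carrier E"
    show "(cmod (spectrum_sum h T m f v))\<^sup>2 = (if v \<in> F then real ((h\<^sup>2 * q) ^ m) else 0)"
    proof (cases "v \<in> F")
      case True thus ?thesis using spectrum_on_F[OF A True] by simp
    next
      case False thus ?thesis using spectrum_off_F[OF v False] by simp
    qed
  qed
  moreover have "real ((h\<^sup>2 * q) ^ m) \<noteq> 0" using h_pos q_pos by simp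
  hence ?P
    unfolding gen_plateaued_def using S hary_map_expansion[unfolded E_full]
    by (intro conjI exI[of _ "real ((h\<^sup>2 * q) ^ m)"]) (simp_all split: if_splits)
  ultimately show "?P \<and> ?S" by blast
qed

section \<open>Generalized partially bent functions\<close>

lemma GPBF_if_AC:
  assumes A: "\<forall>g\<in>carrier E - L. AC h E f g = 0"
  shows "is_GPBF h T m f"
proof -
  have "cmod (AC h E f x) \<in> {0, real (T ^ m)}" if x: "x \<in> carrier E" for x
  proof (cases "x \<in> L")
    case True
    thus ?thesis unfolding Q.AC_on_L[OF True] order_full[symmetric] by (simp add: norm_mult)
  next
    case False
    thus ?thesis using A x by simp
  qed
  thus ?thesis unfolding is_GPBF_def E_full[symmetric] using hary_map_expansion by blast
qed

text \<open>If \<open>|AC f g|\<close> is maximal then \<open>f (w \<otimes> g) - f w\<close> does not depend on \<open>w\<close>. For \<open>h = q\<close> the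
  \<open>h\<close>-th power of \<open>g\<close> lies in \<open>L\<close>, and evaluating \<open>f\<close> there yields \<open>\<Sum>\<^sub>i g\<^sub>i \<equiv> 0\<close>.\<close>

lemma AC_maximal_imp_mult:
  assumes g: "g \<in> carrier E" and max: "cmod (AC h E f g) = real (order E)" and w: "w \<in> carrier E"
  shows "[f (w \<otimes>\<^bsub>E\<^esub> g) = f w + f g] (mod int h)"
proof -
  have "zeta h powi (f w - f (w \<otimes>\<^bsub>E\<^esub> g)) = zeta h powi (f \<one>\<^bsub>E\<^esub> - f (\<one>\<^bsub>E\<^esub> \<otimes>\<^bsub>E\<^esub> g))"
    using max unfolding AC_def order_def
    by (intro sum_unimodular_maximal_imp_const[OF fin_E, where u = "\<lambda>w. zeta h powi (f w - f (w \<otimes>\<^bsub>E\<^esub> g))"])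
      (use w in simp_all)
  hence "zeta h powi (f w - f (w \<otimes>\<^bsub>E\<^esub> g)) * zeta h powi (f g) = zeta h powi (- f g) * zeta h powi (f g)"
    using g by (simp add: Q.f_one)
  hence "zeta h powi ((f w - f (w \<otimes>\<^bsub>E\<^esub> g)) + f g) = 1"
    by (simp flip: power_int_add)
  hence "int h dvd (f w - f (w \<otimes>\<^bsub>E\<^esub> g)) + f g"
    by (simp only: zeta_powi_eq_1_iff[OF h_pos(1)])
  hence "[f w + f g = f (w \<otimes>\<^bsub>E\<^esub> g)] (mod int h)" by (simp add: cong_iff_dvd_diff algebra_simps)
  thus ?thesis by (rule cong_sym)
qed

lemma AC_maximal_imp_sum_eq_0:
  assumes hq: "h = q" and g: "g \<in> carrier E"
    and mult: "\<And>w. w \<in> carrier E \<Longrightarrow> [f (w \<otimes>\<^bsub>E\<^esub> g) = f w + f g] (mod int h)"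
  shows "[(\<Sum>i\<in>{1..m}. g i) = 0] (mod int h)"
proof -
  have pow: "[f (g [^]\<^bsub>E\<^esub> n) = int n * f g] (mod int h)" for n :: nat
  proof (induction n)
    case 0 show ?case by (simp add: Q.f_one)
  next
    case (Suc n)
    have "[f (g [^]\<^bsub>E\<^esub> n \<otimes>\<^bsub>E\<^esub> g) = f (g [^]\<^bsub>E\<^esub> n) + f g] (mod int h)"
      using g by (intro mult) simp
    also have "[f (g [^]\<^bsub>E\<^esub> n) + f g = int n * f g + f g] (mod int h)"
      using Suc.IH by (rule cong_add) simp
    finally show ?case by (simp add: algebra_simps)
  qed
  \<comment> \<open>Left unreduced, so that its quotients by q are the coordinates of g while its
    residues modulo q vanish. This is the second evaluation of f at the q-th power, against q f g =
    0 from \<open>pow\<close>.\<close>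
  let ?u = "\<lambda>i. int q * g i"
  have "g [^]\<^bsub>E\<^esub> q = (\<lambda>i\<in>{1..m}. ?u i mod int (t i))"
    using g unfolding E_eq by (rule pow_cyc_prod)
  hence "[f (g [^]\<^bsub>E\<^esub> q) = \<phi> (red ?u) + (\<Sum>i\<in>J. ?u i div int q)] (mod int h)"
    using expansion_mod[of ?u] by simp
  moreover have "red ?u = \<one>\<^bsub>G\<^esub>" by (auto simp: red_def one_cyc_prod)
  ultimately have "[f (g [^]\<^bsub>E\<^esub> q) = (\<Sum>i\<in>{1..m}. g i)] (mod int h)"
    using phi_one q_pos J_eq by simp
  moreover have "[f (g [^]\<^bsub>E\<^esub> q) = 0] (mod int h)"
    using pow[of q] hq by (simp add: cong_def)
  ultimately show ?thesis by (meson cong_sym cong_trans)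
qed

text \<open>A nonzero value at g is maximal, hence f is additive along g. Writing g as
  \<open>red g\<close> times l and removing f l from both sides gives additivity along y =
  \<open>red g\<close>, which is not the identity because g is outside \<open>L\<close>. The x
  supplied by \<open>ex\<close> for this y contradicts it.\<close>

lemma AC_if_GPBF:
  assumes hq: "h = q"
    and ex: "\<And>y. y \<in> carrier G \<Longrightarrow> y \<noteq> \<one>\<^bsub>G\<^esub> \<Longrightarrow> [(\<Sum>i\<in>{1..m}. y i) = 0] (mod int h) \<Longrightarrow>
      \<exists>x\<in>carrier G. \<not> [\<phi> (x \<otimes>\<^bsub>G\<^esub> y) + (\<Sum>i\<in>{1..m}. (x i + y i) div int h) = \<phi> x + \<phi> y] (mod int h)"
    and B: "is_GPBF h T m f" and g: "g \<in> carrier E - L"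
  shows "AC h E f g = 0"
proof (rule ccontr)
  assume nz: "AC h E f g \<noteq> 0"
  have gE: "g \<in> carrier E" using g by simp
  have "cmod (AC h E f g) \<in> {0, real (T ^ m)}"
    using B gE unfolding is_GPBF_def E_full[symmetric] by blast
  hence "cmod (AC h E f g) = real (order E)" using nz unfolding order_full by auto
  note mult = AC_maximal_imp_mult[OF gE this]
  have sum: "[(\<Sum>i\<in>{1..m}. g i) = 0] (mod int h)" using hq gE mult by (rule AC_maximal_imp_sum_eq_0)
  let ?y = "red g"
  have y: "?y \<in> carrier G" "?y \<noteq> \<one>\<^bsub>G\<^esub>" using red_in_G L_iff_red[OF gE] g by auto
  \<comment> \<open>Reduction modulo q preserves the coordinate sum modulo h, since h = q.\<close>
  have "[(\<Sum>i\<in>{1..m}. ?y i) = (\<Sum>i\<in>{1..m}. g i)] (mod int h)"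
    by (intro cong_sum) (simp add: red_def cong_def hq)
  hence "[(\<Sum>i\<in>{1..m}. ?y i) = 0] (mod int h)" using sum by (rule cong_trans)
  then obtain x where x: "x \<in> carrier G"
    and nx: "\<not> [\<phi> (x \<otimes>\<^bsub>G\<^esub> ?y) + (\<Sum>i\<in>{1..m}. (x i + ?y i) div int h) = \<phi> x + \<phi> ?y] (mod int h)"
    using ex[OF y] by blast
  obtain l where l: "l \<in> L" "g = ?y \<otimes>\<^bsub>E\<^esub> l" using red_decomp[OF gE] by blast
  have E: "x \<in> carrier E" "?y \<in> carrier E" "l \<in> carrier E"
    using x y(1) l(1) G_sub_E by (auto simp: L_iff)
  have 1: "[f (x \<otimes>\<^bsub>E\<^esub> g) = f (x \<otimes>\<^bsub>E\<^esub> ?y) + f l] (mod int h)"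
  proof -
    have "x \<otimes>\<^bsub>E\<^esub> g = (x \<otimes>\<^bsub>E\<^esub> ?y) \<otimes>\<^bsub>E\<^esub> l" using E E.m_assoc[OF E] l(2) by simp
    thus ?thesis using expansion_mult_L[of "x \<otimes>\<^bsub>E\<^esub> ?y" l] E l(1) by simp
  qed
  have 2: "[f g = f ?y + f l] (mod int h)"
    using expansion_mult_L[OF E(2) l(1)] unfolding l(2)[symmetric] .
  have "[f (x \<otimes>\<^bsub>E\<^esub> ?y) + f l = f x + (f ?y + f l)] (mod int h)"
    using cong_trans[OF cong_sym[OF 1] cong_trans[OF mult[OF E(1)] cong_add[OF cong_refl 2]]] .
  hence "[f (x \<otimes>\<^bsub>E\<^esub> ?y) = f x + f ?y] (mod int h)"
    by (simp add: add.assoc[symmetric] cong_add_rcancel)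
  hence "[psi_exponent ?y x + \<phi> ?y + \<phi> x = \<phi> x + \<phi> ?y] (mod int h)"
    using expansion_mult_G[OF y(1) x] unfolding expansion_G[OF x] expansion_G[OF y(1)]
    by (meson cong_sym cong_trans)
  moreover have "psi_exponent ?y x + \<phi> ?y + \<phi> x = \<phi> (x \<otimes>\<^bsub>G\<^esub> ?y) + (\<Sum>i\<in>{1..m}. (x i + ?y i) div int h)"
    unfolding psi_exponent_def J_eq using hq G.m_comm[OF x y(1)] by (simp add: add.commute)
  ultimately show False using nx by simp
qed

end

theorem theorem4p13:
  fixes h q m :: nat and z :: "nat \<Rightarrow> nat" and \<phi> :: "(nat \<Rightarrow> int) \<Rightarrow> int"
  assumes "prime h" and "h dvd q" and "q > 1" and "m \<ge> 1"
    and "hary_map h (cyc_pow q m) \<phi>"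
    and "\<phi> \<one>\<^bsub>cyc_pow q m\<^esub> = 0"
    and "z \<in> {1..m} \<rightarrow> {0, 1}"
    and "\<exists>i\<in>{1..m}. z i \<noteq> 0"
  shows
    "let s = (\<lambda>_. q);
         G = cyc_pow q m;
         E = exp_group h m s z;
         L = L_sub h m s z;
         K = K_sub h m s z;
         \<phi>' = expansion h m s \<phi>;
         \<psi> = (\<lambda>x y. mu_cocycle h m s z x y * coboundary h G \<phi> x y);
         all_one = (\<forall>i\<in>{1..m}. z i = 1);
         cond_i = (symmetric_cocycle G h \<psi> \<and> orthogonal_cocycle G h \<psi>);
         cond_ii = is_GPhA h m s z \<phi>;
         cond_iii = is_nonsplitting_RDS (E Mod K) ((\<lambda>g. K #>\<^bsub>E\<^esub> g) ` L)
            (q ^ m) h (q ^ m) (q ^ m div h) {K #>\<^bsub>E\<^esub> g |g. g \<in> carrier E \<and> \<phi>' g = 0};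
         F = {v \<in> carrier (cyc_pow (h * q) m). \<forall>i\<in>{1..m}. [v i = 1] (mod int h)};
         cond_iv = (gen_plateaued h (h * q) m \<phi>' \<and>
            (\<forall>v \<in> carrier (cyc_pow (h * q) m).
               (cmod (spectrum_sum h (h * q) m \<phi>' v))\<^sup>2 =
                 (if v \<in> F then real ((h\<^sup>2 * q) ^ m) else 0)));
         cond_v = is_GPBF h (h * q) m \<phi>'
     in mu_cocycle h m s z \<in> cocycles G h \<and>
        ((cond_i \<longleftrightarrow> cond_ii) \<and> (cond_ii \<longleftrightarrow> cond_iii)) \<and>
        (all_one \<longrightarrow> (cond_iii \<longleftrightarrow> cond_iv)) \<and>
        (h = q \<and> all_one \<and>
          (\<forall>y \<in> carrier (cyc_pow h m) - {\<one>\<^bsub>cyc_pow h m\<^esub>}.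
             [(\<Sum>i\<in>{1..m}. y i) = 0] (mod int h) \<longrightarrow>
             (\<exists>x \<in> carrier (cyc_pow h m).
                \<not> [\<phi> (x \<otimes>\<^bsub>cyc_pow h m\<^esub> y) + (\<Sum>i\<in>{1..m}. (x i + y i) div int h)
                    = \<phi> x + \<phi> y] (mod int h)))
          \<longrightarrow> (cond_iv \<longleftrightarrow> cond_v))"
proof -
  interpret H: hary_array h q m z \<phi>
    using assms by unfold_locales
  have iv: "(gen_plateaued h (h * q) m H.f \<and> (\<forall>v \<in> carrier (cyc_pow (h * q) m).
      (cmod (spectrum_sum h (h * q) m H.f v))\<^sup>2 =
        (if v \<in> {v \<in> carrier (cyc_pow (h * q) m). \<forall>i\<in>{1..m}. [v i = 1] (mod int h)}
         then real ((h\<^sup>2 * q) ^ m) else 0))) \<longleftrightarrow> is_GPhA h m (\<lambda>_. q) z \<phi>"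
    if all_one: "\<forall>i\<in>{1..m}. z i = 1"
  proof -
    interpret A: hary_array_all_one h q m z \<phi>
      using all_one by unfold_locales blast
    show ?thesis
      using A.cond_iv_iff unfolding H.GPhA_iff A.F_def A.E_full A.T_def .
  qed
  have v: "is_GPBF h (h * q) m H.f \<longleftrightarrow> is_GPhA h m (\<lambda>_. q) z \<phi>"
    if hq: "h = q" and all_one: "\<forall>i\<in>{1..m}. z i = 1"
      and ex: "\<forall>y \<in> carrier (cyc_pow h m) - {\<one>\<^bsub>cyc_pow h m\<^esub>}.
             [(\<Sum>i\<in>{1..m}. y i) = 0] (mod int h) \<longrightarrow>
             (\<exists>x \<in> carrier (cyc_pow h m).
                \<not> [\<phi> (x \<otimes>\<^bsub>cyc_pow h m\<^esub> y) + (\<Sum>i\<in>{1..m}. (x i + y i) div int h)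
                    = \<phi> x + \<phi> y] (mod int h))"
  proof -
    interpret A: hary_array_all_one h q m z \<phi>
      using all_one by unfold_locales blast
    have T: "h * q = A.T" by (simp add: A.T_def)
    have pow: "cyc_pow q m = cyc_pow h m" using hq by simp
    show ?thesis
    proof
      assume B: "is_GPBF h (h * q) m H.f"
      show "is_GPhA h m (\<lambda>_. q) z \<phi>"
        unfolding H.GPhA_iff
      proof
        fix g assume g: "g \<in> carrier H.E - H.L"
        show "AC h H.E H.f g = 0"
        proof (rule A.AC_if_GPBF[OF hq _ B[unfolded T] g])
          fix y assume "y \<in> carrier H.G" "y \<noteq> \<one>\<^bsub>H.G\<^esub>" "[(\<Sum>i\<in>{1..m}. y i) = 0] (mod int h)"
          thus "\<exists>x\<in>carrier H.G. \<not> [\<phi> (x \<otimes>\<^bsub>H.G\<^esub> y) + (\<Sum>i\<in>{1..m}. (x i + y i) div int h)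
              = \<phi> x + \<phi> y] (mod int h)"
            using ex[unfolded pow[symmetric]] by blast
        qed
      qed
    next
      assume "is_GPhA h m (\<lambda>_. q) z \<phi>"
      thus "is_GPBF h (h * q) m H.f" unfolding H.GPhA_iff T by (rule A.GPBF_if_AC)
    qed
  qed
  have psi: "H.\<psi> = (\<lambda>x y. mu_cocycle h m (\<lambda>_. q) z x y * coboundary h (cyc_pow q m) \<phi> x y)"
    by (simp add: H.\<psi>_def fun_eq_iff)
  show ?thesis
    unfolding Let_def
  proof (intro conjI impI; (elim conjE)?)
    show "mu_cocycle h m (\<lambda>_. q) z \<in> cocycles (cyc_pow q m) h" by (rule H.mu_cocycle)
  \<comment> \<open>The links from (iii) to (iv) and from (iv) to (v) pass through (ii), with which
    each of these conditions has been compared under its own assumptions.\<close>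
  qed (rule H.cond_i_iff[unfolded psi] H.cond_iii_iff[symmetric]
      trans[OF H.cond_iii_iff iv[symmetric]] trans[OF iv v[symmetric]]; assumption)+
qed

end
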